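(* Let $G=\frac1n\sum_{i=1}^nG_i$ with $G_i:\mathbb{R}^p\to\mathbb{R}^p$, and suppose that: $\{x:Gx=0\}\ne\emptyset$; there is $L>0$ with $\frac1n\sum_{i=1}^n\|G_ix-G_iy\|^2\le L^2\|x-y\|^2$ for all $x,y\in\mathbb{R}^p$; and there exist $x^\star$ with $Gx^\star=0$ and $\kappa\ge0$ such that $\langle Gx,x-x^\star\rangle\ge-\kappa\|Gx\|^2$ for all $x\in\mathbb{R}^p$. Let $\gamma\in(\frac12,1)$, let $b$ be an integer with $1\le b\le n^{2/3}$, and set $$\Lambda:=\frac2b+\frac{4(1+\gamma^2)(n-b)(2n+b)}{b^3},\qquad M:=\frac{\gamma(1+5\gamma)}{3(2\gamma-1)}+\frac{1+6\gamma}{3(2\gamma-1)}\Lambda,\qquad\eta:=\frac1{L\sqrt M}.$$ Assume $L\kappa\le\frac{2\gamma-1}{8\sqrt M}$. Let $\{x^k\}$ be generated by $x^{k+1}:=x^k-\eta\widetilde S^k_\gamma$, $k\ge0$, using the SAGA estimator $\widetilde S^k_\gamma$ (see context) with batch size $b$. Then $\eta\ge\frac{\sigma b^{3/2}}{nL}$ for $\sigma:=\frac{\sqrt{3(2\gamma-1)}}{\sqrt{10+61\gamma+13\gamma^2+48\gamma^3}}$, and for every $K\ge0$, $$\frac1{K+1}\sum_{k=0}^K\mathbb{E}\big[\|Gx^k\|^2\big]\le\frac{2(1+L^2\eta^2)R_0^2}{\gamma(1-\gamma)\eta^2(K+1)},\qquad R_0:=\|x^0-x^\star\|.$$ Moreover,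 for a given tolerance $\epsilon>0$, if $b:=\lfloor n^{2/3}\rfloor$, then the method requires $$\mathcal{T}_{G_i}:=n+\Big\lfloor\frac{3\Gamma L^2R_0^2n^{2/3}}{\epsilon^2}\Big\rfloor,\qquad\Gamma:=\frac{2(7\gamma+5\gamma^2-3)(10+61\gamma+13\gamma^2+48\gamma^3)}{3\gamma^2(1-\gamma)(2\gamma-1)(1+5\gamma)},$$ evaluations of the $G_i$ to achieve $\frac1{K+1}\sum_{k=0}^K\mathbb{E}[\|Gx^k\|^2]\le\epsilon^2$; that is, there is $K$ for which this inequality holds and such that producing $x^0,\dots,x^K$ uses at most $\mathcal{T}_{G_i}$ evaluations of the components $G_i$.
   Context: Norms and inner products are Euclidean; $x^0$ is deterministic and $x^{-1}:=x^0$. SAGA estimator. Put $\hat G_i^0:=G_ix^0$ for all $i$. At each iteration $k\ge0$, a mini-batch $\mathcal{B}_k\subseteq\{1,\dots,n\}$ of fixed size $b$ is drawn uniformly at random, independently of everything generated before; with $G_{\mathcal{B}_k}z:=\frac1b\sum_{i\in\mathcal{B}_k}G_iz$ and $\hat G^k_{\mathcal{B}_k}:=\frac1b\sum_{i\in\mathcal{B}_k}\hat G_i^k$ one sets $$\widetilde S^k_\gamma:=\big[G_{\mathcal{B}_k}x^k-\gamma G_{\mathcal{B}_k}x^{k-1}-(1-\gamma)\hat G^k_{\mathcal{B}_k}\big]+\frac{1-\gamma}n\sum_{i=1}^n\hat G_i^k$$ (so $\widetilde S^0_\gamma=(1-\gamma)Gx^0$), and the table is updated by $\hat G_i^{k+1}:=G_ix^k$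 if $i\in\mathcal{B}_k$ and $\hat G_i^{k+1}:=\hat G_i^k$ otherwise. Counting of evaluations: $n$ for the initial table $G_ix^0$, and at each iteration the values $G_ix^k$ and $G_ix^{k-1}$ for $i\in\mathcal{B}_k$. Producing $x^0,\dots,x^K$ takes $K$ iterations. *)

theory Defs
  imports "HOL-Probability.Probability"
begin

definition avg :: "nat \<Rightarrow> nat set \<Rightarrow> (nat \<Rightarrow> 'v::real_vector) \<Rightarrow> 'v" where
  "avg m I v = (1 / real m) *\<^sub>R (\<Sum>i\<in>I. v i)"

definition mean_op :: "nat \<Rightarrow> (nat \<Rightarrow> 'v::real_vector \<Rightarrow> 'v) \<Rightarrow> 'v \<Rightarrow> 'v" where
  "mean_op n G z = avg n {1..n} (\<lambda>i. G i z)"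

definition batches :: "nat \<Rightarrow> nat \<Rightarrow> nat set set" where
  "batches n b = {S. S \<subseteq> {1..n} \<and> card S = b}"

text \<open>The starting point is deterministic, so the batches are the only source of randomness, and
  drawing each one independently of the past is mutual independence of the whole sequence.\<close>

definition uniform_minibatches ::
  "'w measure \<Rightarrow> nat \<Rightarrow> nat \<Rightarrow> (nat \<Rightarrow> 'w \<Rightarrow> nat set) \<Rightarrow> bool" where
  "uniform_minibatches P n b B \<longleftrightarrow>
     prob_space.indep_vars P (\<lambda>_. count_space (batches n b)) B UNIV \<and>
     (\<forall>k. distr P (count_space (batches n b)) (B k) = uniform_count_measure (batches n b))"

primrec saga_table ::
  "(nat \<Rightarrow> 'v \<Rightarrow> 'v) \<Rightarrow> (nat \<Rightarrow> nat set) \<Rightarrow> (nat \<Rightarrow> 'v) \<Rightarrow> nat \<Rightarrow> nat \<Rightarrow> 'v" where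
  "saga_table G B x 0 = (\<lambda>i. G i (x 0))"
| "saga_table G B x (Suc k) = (\<lambda>i. if i \<in> B k then G i (x k) else saga_table G B x k i)"

text \<open>For \<open>k = 0\<close> the truncated subtraction makes \<open>x (k - 1)\<close> equal to \<open>x 0\<close>, which is the
  convention for the iterate with index \<open>-1\<close>.\<close>

definition saga_estimator ::
  "nat \<Rightarrow> nat \<Rightarrow> (nat \<Rightarrow> 'v::real_vector \<Rightarrow> 'v) \<Rightarrow> real \<Rightarrow> (nat \<Rightarrow> nat set) \<Rightarrow> (nat \<Rightarrow> 'v) \<Rightarrow> nat \<Rightarrow> 'v"
  where
  "saga_estimator n b G \<gamma> B x k =
     (avg b (B k) (\<lambda>i. G i (x k)) - \<gamma> *\<^sub>R avg b (B k) (\<lambda>i. G i (x (k - 1)))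
        - (1 - \<gamma>) *\<^sub>R avg b (B k) (saga_table G B x k))
     + (1 - \<gamma>) *\<^sub>R avg n {1..n} (saga_table G B x k)"

definition saga_iterates ::
  "nat \<Rightarrow> nat \<Rightarrow> (nat \<Rightarrow> 'v::real_vector \<Rightarrow> 'v) \<Rightarrow> real \<Rightarrow> real \<Rightarrow> 'v \<Rightarrow> (nat \<Rightarrow> nat set) \<Rightarrow> (nat \<Rightarrow> 'v) \<Rightarrow> bool"
  where
  "saga_iterates n b G \<gamma> \<eta> x0 B x \<longleftrightarrow>
     x 0 = x0 \<and> (\<forall>k. x (Suc k) = x k - \<eta> *\<^sub>R saga_estimator n b G \<gamma> B x k)"

text \<open>Component evaluations used to produce the iterates \<open>0, \<dots>, K\<close>: the initial table, and then two
  for every sampled index in each of the \<open>K\<close> iterations (at the current and at the previous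
  iterate; values already known are not discounted).\<close>

definition saga_evaluations :: "nat \<Rightarrow> (nat \<Rightarrow> nat set) \<Rightarrow> nat \<Rightarrow> nat" where
  "saga_evaluations n B K = n + (\<Sum>k<K. 2 * card (B k))"

definition saga_Lambda :: "nat \<Rightarrow> nat \<Rightarrow> real \<Rightarrow> real" where
  "saga_Lambda n b \<gamma> =
     2 / real b + 4 * (1 + \<gamma>\<^sup>2) * (real n - real b) * (2 * real n + real b) / real b ^ 3"

definition saga_M :: "nat \<Rightarrow> nat \<Rightarrow> real \<Rightarrow> real" where
  "saga_M n b \<gamma> = \<gamma> * (1 + 5 * \<gamma>) / (3 * (2 * \<gamma> - 1))
     + (1 + 6 * \<gamma>) / (3 * (2 * \<gamma> - 1)) * saga_Lambda n b \<gamma>"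

definition saga_eta :: "nat \<Rightarrow> nat \<Rightarrow> real \<Rightarrow> real \<Rightarrow> real" where
  "saga_eta n b \<gamma> L = 1 / (L * sqrt (saga_M n b \<gamma>))"

definition saga_sigma :: "real \<Rightarrow> real" where
  "saga_sigma \<gamma> = sqrt (3 * (2 * \<gamma> - 1)) / sqrt (10 + 61 * \<gamma> + 13 * \<gamma>\<^sup>2 + 48 * \<gamma> ^ 3)"

definition saga_Gamma :: "real \<Rightarrow> real" where
  "saga_Gamma \<gamma> =
     2 * (7 * \<gamma> + 5 * \<gamma>\<^sup>2 - 3) * (10 + 61 * \<gamma> + 13 * \<gamma>\<^sup>2 + 48 * \<gamma> ^ 3)
     / (3 * \<gamma>\<^sup>2 * (1 - \<gamma>) * (2 * \<gamma> - 1) * (1 + 5 * \<gamma>))"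

end

theory Submission
  imports Defs
begin

text \<open>
  Write \<open>g k\<close> for the value of \<open>G\<close> at the \<open>k\<close>-th iterate. The estimator is an unbiased estimate of the
  reflected direction \<open>g k - \<gamma> g (k - 1)\<close>. Shifting the iterate to \<open>x k + \<gamma> \<eta> g (k - 1)\<close> turns the
  reflected step into a plain step of length \<open>(1 - \<gamma>) \<eta>\<close> along \<open>- g k\<close>, up to noise. Expanding the
  squared distance of the shifted iterate to \<open>xstar\<close> and using the weak Minty inequality produces
  negative multiples of \<open>\<parallel>g k\<parallel>\<^sup>2\<close> and of \<open>\<parallel>g (k - 1)\<parallel>\<^sup>2\<close>, and two error terms: the displacement
  \<open>\<parallel>x k - x (k - 1)\<parallel>\<^sup>2\<close>, through the Lipschitz bound, and the variance of the noise.

  The variance is at most \<open>1 / b\<close> times the mean square of the vectors that are averaged over the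
  batch. Each of these is a convex combination of the staleness \<open>G i (x k) - T i\<close> of a table entry
  and of \<open>G i (x k) - G i (x (k - 1))\<close>, so the variance is controlled by the mean squared staleness
  and by the displacement. The staleness contracts by the factor \<open>1 - b / (2 n)\<close> in expectation,
  because an entry is refreshed with probability \<open>b / n\<close>, and is fed only by the next displacement.
  Finally the expected next displacement is bounded by \<open>\<eta>\<^sup>2 (1 - \<gamma>) \<parallel>g k\<parallel>\<^sup>2\<close> plus terms already present.

  Adding the three quantities with suitable weights gives a potential that decreases in conditional
  expectation by \<open>\<gamma> (1 - \<gamma>) \<eta>\<^sup>2 \<parallel>g (k - 1)\<parallel>\<^sup>2\<close> (\<open>potential_descent\<close>). The step size condition enters through one
  inequality only (\<open>displacement_weight\<close>), and this is where the form of \<open>saga_M\<close> comes from. The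
  descent involves only the current iterate, the previous one and the table, and it is averaged over a
  fresh uniform batch; independence of the batches (\<open>uniform_resampling\<close>) carries it over to
  expectations, and summation over \<open>k\<close> gives the rate (\<open>expected_residual_sum\<close>).

  The bound on the step size and the evaluation count are then statements about real numbers. For
  \<open>b = \<lfloor>n powr (2/3)\<rfloor>\<close> the count needs an estimate that absorbs the loss in rounding
  (\<open>floor_batch_bound\<close>).
\<close>

section \<open>Averages over uniformly drawn batches\<close>

lemma card_batches_containing:
  assumes "D \<subseteq> {1..n}" "card D \<le> b"
  shows "card {S \<in> batches n b. D \<subseteq> S} = (n - card D) choose (b - card D)"
proof -
  have finD: "finite D" using assms(1) finite_subset by blast
  have "bij_betw (\<lambda>T. T \<union> D) {T. T \<subseteq> {1..n} - D \<and> card T = b - card D} {S \<in> batches n b. D \<subseteq> S}"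
  proof (rule bij_betwI[where g = "\<lambda>S. S - D"])
    show "(\<lambda>T. T \<union> D) \<in> {T. T \<subseteq> {1..n} - D \<and> card T = b - card D} \<rightarrow> {S \<in> batches n b. D \<subseteq> S}"
    proof
      fix T assume T: "T \<in> {T. T \<subseteq> {1..n} - D \<and> card T = b - card D}"
      then have "finite T" using finite_subset by blast
      moreover have "T \<inter> D = {}" using T by blast
      ultimately have "card (T \<union> D) = b" using T finD assms(2) by (simp add: card_Un_disjoint)
      then show "T \<union> D \<in> {S \<in> batches n b. D \<subseteq> S}" using T assms(1) by (auto simp: batches_def)
    qed
    show "(\<lambda>S. S - D) \<in> {S \<in> batches n b. D \<subseteq> S} \<rightarrow> {T. T \<subseteq> {1..n} - D \<and> card T = b - card D}"
      using finD by (auto simp: batches_def card_Diff_subset)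
  qed auto
  then have "card {S \<in> batches n b. D \<subseteq> S} = card {T. T \<subseteq> {1..n} - D \<and> card T = b - card D}"
    by (simp add: bij_betw_same_card)
  also have "\<dots> = (n - card D) choose (b - card D)"
    using assms(1) finD by (simp add: n_subsets card_Diff_subset)
  finally show ?thesis .
qed

lemma finite_batches [simp]: "finite (batches n b)"
  by (auto simp: batches_def intro: finite_subset[of _ "Pow {1..n}"])

lemma card_batches: "card (batches n b) = n choose b"
  using card_batches_containing[of "{}" n b] by simp

lemma card_batches_pos:
  assumes "b \<le> n" shows "0 < card (batches n b)"
  using assms by (simp add: card_batches)

lemma sum_batches_containing:
  fixes f :: "nat \<Rightarrow> 'v::real_vector"
  shows "(\<Sum>S\<in>batches n b. \<Sum>i\<in>S. f i)
    = (\<Sum>i=1..n. real (card {S \<in> batches n b. i \<in> S}) *\<^sub>R f i)"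
proof -
  have "(\<Sum>S\<in>batches n b. \<Sum>i\<in>S. f i) = (\<Sum>S\<in>batches n b. \<Sum>i\<in>{i\<in>{1..n}. i \<in> S}. f i)"
    by (intro sum.cong refl) (auto simp: batches_def)
  also have "\<dots> = (\<Sum>i=1..n. \<Sum>S\<in>{S \<in> batches n b. i \<in> S}. f i)"
    by (rule sum.swap_restrict) auto
  finally show ?thesis by (simp add: sum_constant_scaleR)
qed

lemma card_batches_containing_elem:
  assumes "1 \<le> b" "b \<le> n" "i \<in> {1..n}"
  shows "real (card {S \<in> batches n b. i \<in> S}) = real b / real n * real (card (batches n b))"
proof -
  have "card {S \<in> batches n b. i \<in> S} = (n - 1) choose (b - 1)"
    using card_batches_containing[of "{i}" n b] assms by simp
  moreover have "b * (n choose b) = n * ((n - 1) choose (b - 1))"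
    using assms by (intro times_binomial_minus1_eq) simp
  ultimately have "real n * real (card {S \<in> batches n b. i \<in> S}) = real b * real (card (batches n b))"
    by (metis card_batches of_nat_mult)
  then show ?thesis using assms by (simp add: field_simps)
qed

lemma sum_batches_sum:
  fixes f :: "nat \<Rightarrow> 'v::real_vector"
  assumes "1 \<le> b" "b \<le> n"
  shows "(\<Sum>S\<in>batches n b. \<Sum>i\<in>S. f i)
    = (real b / real n * real (card (batches n b))) *\<^sub>R (\<Sum>i=1..n. f i)"
  unfolding sum_batches_containing scaleR_sum_right
  by (intro sum.cong refl) (simp only: card_batches_containing_elem[OF assms])

lemma batch_avg_unbiased:
  fixes v :: "nat \<Rightarrow> 'v::real_vector"
  assumes "1 \<le> b" "b \<le> n"
  shows "(\<Sum>S\<in>batches n b. avg b S v - avg n {1..n} v) = 0"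
proof -
  have "(\<Sum>S\<in>batches n b. avg b S v) = (1 / real b) *\<^sub>R (\<Sum>S\<in>batches n b. \<Sum>i\<in>S. v i)"
    by (simp add: avg_def scaleR_sum_right)
  also have "\<dots> = real (card (batches n b)) *\<^sub>R avg n {1..n} v"
    using assms by (simp add: sum_batches_sum avg_def)
  finally show ?thesis by (simp add: sum_subtractf sum_constant_scaleR)
qed

text \<open>The bias-variance decomposition. It gives both the Jensen inequality \<open>norm_avg_sq_le\<close> and the
  passage from centred to raw second moments.\<close>

lemma sum_norm_sq_deviation:
  fixes v :: "nat \<Rightarrow> 'v::real_inner"
  shows "(\<Sum>i=1..n. (norm (v i - avg n {1..n} v))\<^sup>2)
    = (\<Sum>i=1..n. (norm (v i))\<^sup>2) - real n * (norm (avg n {1..n} v))\<^sup>2"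
proof (cases "n = 0")
  case False
  let ?m = "avg n {1..n} v"
  have "(\<Sum>i=1..n. v i) = real n *\<^sub>R ?m" using False by (simp add: avg_def)
  then have "(\<Sum>i=1..n. v i \<bullet> ?m) = real n * (?m \<bullet> ?m)"
    by (metis inner_scaleR_left inner_sum_left)
  then have "(\<Sum>i=1..n. v i \<bullet> v i - 2 * (v i \<bullet> ?m) + ?m \<bullet> ?m) = (\<Sum>i=1..n. v i \<bullet> v i) - real n * (?m \<bullet> ?m)"
    by (simp add: sum.distrib sum_subtractf flip: sum_distrib_left)
  moreover have "(norm (v i - ?m))\<^sup>2 = v i \<bullet> v i - 2 * (v i \<bullet> ?m) + ?m \<bullet> ?m" for i
    by (simp add: power2_norm_eq_inner inner_diff inner_commute)
  ultimately show ?thesis by (simp add: power2_norm_eq_inner)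
qed simp

lemma norm_avg_sq_le:
  fixes v :: "nat \<Rightarrow> 'v::real_inner"
  shows "(norm (avg n {1..n} v))\<^sup>2 \<le> (1 / real n) * (\<Sum>i=1..n. (norm (v i))\<^sup>2)"
proof (cases "n = 0")
  case False
  have "0 \<le> (\<Sum>i=1..n. (norm (v i - avg n {1..n} v))\<^sup>2)" by (simp add: sum_nonneg)
  with False show ?thesis unfolding sum_norm_sq_deviation by (simp add: field_simps)
qed (simp add: avg_def)

text \<open>Expanding the square gives a quadratic form whose coefficients are the numbers of batches that
  contain a given pair. They take one value on the diagonal and one nonnegative value off it, and
  for centred vectors the constant off-diagonal part multiplies \<open>\<parallel>\<Sum>i. u i\<parallel>\<^sup>2 = 0\<close>.\<close>

lemma batch_sum_centred_le:
  fixes u :: "nat \<Rightarrow> 'v::real_inner"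
  assumes "1 \<le> b" "b \<le> n" and centred: "(\<Sum>i=1..n. u i) = 0"
  shows "(\<Sum>S\<in>batches n b. (norm (\<Sum>i\<in>S. u i))\<^sup>2)
    \<le> real b / real n * real (card (batches n b)) * (\<Sum>i=1..n. (norm (u i))\<^sup>2)"
proof -
  define c where "c i j = real (card {S \<in> batches n b. i \<in> S \<and> j \<in> S})" for i j
  define c1 where "c1 = real b / real n * real (card (batches n b))"
  define c2 where "c2 = (if 2 \<le> b then real ((n - 2) choose (b - 2)) else 0)"
  have diag: "c i i = c1" if "i \<in> {1..n}" for i
    using card_batches_containing_elem[OF assms(1,2) that] by (simp add: c_def c1_def)
  have off: "c i j = c2" if "i \<in> {1..n}" "j \<in> {1..n}" "i \<noteq> j" for i j
  proof (cases "2 \<le> b")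
    case True
    then show ?thesis
      using card_batches_containing[of "{i, j}" n b] that by (simp add: c_def c2_def numeral_2_eq_2)
  next
    case False
    have "\<not> (i \<in> S \<and> j \<in> S)" if "S \<in> batches n b" for S
    proof
      assume "i \<in> S \<and> j \<in> S"
      moreover have "finite S" using that by (auto simp: batches_def intro: finite_subset)
      ultimately have "card {i, j} \<le> card S" by (intro card_mono) auto
      then show False using False that \<open>i \<noteq> j\<close> by (simp add: batches_def)
    qed
    then have "{S \<in> batches n b. i \<in> S \<and> j \<in> S} = {}" by blast
    then show ?thesis using False by (simp only: c_def c2_def) simp
  qed
  have "(\<Sum>S\<in>batches n b. (norm (\<Sum>i\<in>S. u i))\<^sup>2)
      = (\<Sum>S\<in>batches n b. \<Sum>(i, j)\<in>S \<times> S. u i \<bullet> u j)"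
    by (simp add: power2_norm_eq_inner inner_sum_left inner_sum_right sum.cartesian_product)
      (simp only: inner_commute)
  also have "\<dots> = (\<Sum>S\<in>batches n b. \<Sum>z\<in>{z\<in>{1..n} \<times> {1..n}. fst z \<in> S \<and> snd z \<in> S}. u (fst z) \<bullet> u (snd z))"
    by (intro sum.cong refl) (auto simp: batches_def)
  also have "\<dots> = (\<Sum>z\<in>{1..n} \<times> {1..n}. \<Sum>S\<in>{S \<in> batches n b. fst z \<in> S \<and> snd z \<in> S}. u (fst z) \<bullet> u (snd z))"
    by (rule sum.swap_restrict) auto
  also have "\<dots> = (\<Sum>i=1..n. \<Sum>j=1..n. c i j * (u i \<bullet> u j))"
    by (simp add: sum.cartesian_product c_def case_prod_unfold)
  also have "\<dots> = (\<Sum>i=1..n. \<Sum>j=1..n. c2 * (u i \<bullet> u j) + (if i = j then (c1 - c2) * (u i \<bullet> u j) else 0))"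
    using diag off by (intro sum.cong refl) (auto simp: algebra_simps)
  also have "\<dots> = c2 * ((\<Sum>i=1..n. u i) \<bullet> (\<Sum>j=1..n. u j)) + (c1 - c2) * (\<Sum>i=1..n. u i \<bullet> u i)"
    by (simp add: sum.distrib inner_sum_left inner_sum_right sum_distrib_left)
      (simp only: inner_commute)
  also have "\<dots> \<le> c1 * (\<Sum>i=1..n. (norm (u i))\<^sup>2)"
    unfolding centred
    by (simp add: power2_norm_eq_inner c2_def algebra_simps sum_nonneg mult_nonneg_nonneg)
  finally show ?thesis by (simp add: c1_def)
qed

text \<open>Sampling without replacement has at most the variance of \<open>b\<close> independent draws. The right-hand
  side replaces the variance of a single draw by its second moment, which is no smaller.\<close>

lemma batch_avg_variance:
  fixes v :: "nat \<Rightarrow> 'v::real_inner"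
  assumes "1 \<le> b" "b \<le> n"
  shows "(\<Sum>S\<in>batches n b. (norm (avg b S v - avg n {1..n} v))\<^sup>2)
    \<le> real (card (batches n b)) * ((1 / real b) * ((1 / real n) * (\<Sum>i=1..n. (norm (v i))\<^sup>2)))"
proof -
  define u where "u i = v i - avg n {1..n} v" for i
  have dev: "avg b S v - avg n {1..n} v = (1 / real b) *\<^sub>R (\<Sum>i\<in>S. u i)" if "S \<in> batches n b" for S
    using that assms(1)
    by (simp add: batches_def avg_def u_def sum_subtractf sum_constant_scaleR scaleR_diff_right)
  have "(\<Sum>i=1..n. u i) = 0"
    using assms by (simp add: u_def avg_def sum_subtractf sum_constant_scaleR)
  note centred = batch_sum_centred_le[OF assms this]
  have "(\<Sum>S\<in>batches n b. (norm (avg b S v - avg n {1..n} v))\<^sup>2)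
      = (1 / real b)\<^sup>2 * (\<Sum>S\<in>batches n b. (norm (\<Sum>i\<in>S. u i))\<^sup>2)"
    unfolding sum_distrib_left by (intro sum.cong refl) (simp only: dev, simp add: power_divide)
  also have "\<dots> \<le> (1 / real b)\<^sup>2 * (real b / real n * real (card (batches n b)) * (\<Sum>i=1..n. (norm (v i))\<^sup>2))"
  proof (intro mult_left_mono order_trans[OF centred])
    show "(\<Sum>i=1..n. (norm (u i))\<^sup>2) \<le> (\<Sum>i=1..n. (norm (v i))\<^sup>2)"
      unfolding u_def sum_norm_sq_deviation by simp
  qed auto
  also have "\<dots> = real (card (batches n b)) * ((1 / real b) * ((1 / real n) * (\<Sum>i=1..n. (norm (v i))\<^sup>2)))"
    using assms by (simp add: power2_eq_square field_simps)
  finally show ?thesis .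
qed

section \<open>Independent batches and resampling\<close>

text \<open>A functional of the first \<open>k\<close> samples factors through the tuple of these samples, which lives in a
  finite product of discrete spaces; there every function is measurable, so the independence of
  the tuple and the next sample passes to the functional.\<close>

lemma (in prob_space) finite_history_independent_of_next:
  fixes B :: "nat \<Rightarrow> 'a \<Rightarrow> 'b" and F :: "(nat \<Rightarrow> 'b) \<Rightarrow> real"
  assumes indep: "indep_vars (\<lambda>_. count_space \<Omega>) B UNIV" and fin: "finite \<Omega>"
    and local: "\<And>s s'. (\<And>j. j < k \<Longrightarrow> s j = s' j) \<Longrightarrow> F s = F s'"
  shows "integrable M (\<lambda>\<omega>. F (\<lambda>j. B j \<omega>))"
    and "expectation (\<lambda>\<omega>. F (\<lambda>j. B j \<omega>) * indicator {S} (B k \<omega>))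
      = expectation (\<lambda>\<omega>. F (\<lambda>j. B j \<omega>)) * expectation (\<lambda>\<omega>. indicator {S} (B k \<omega>))"
proof -
  let ?H = "\<lambda>\<omega>. restrict (\<lambda>j. B j \<omega>) {..<k}"
  let ?PM = "PiM {..<k} (\<lambda>_. count_space \<Omega>)"
  have finPi: "finite (PiE {..<k} (\<lambda>_. \<Omega>))" by (intro finite_PiE) (auto simp: fin)
  have singleton: "{h} \<in> sets ?PM" if "h \<in> PiE {..<k} (\<lambda>_. \<Omega>)" for h
  proof -
    have "{h} = PiE {..<k} (\<lambda>j. {h j})" using PiE_singleton[of h "{..<k}"] that by (auto simp: PiE_iff)
    also have "\<dots> \<in> sets ?PM" using that by (intro sets_PiM_I_finite) auto
    finally show ?thesis .
  qed
  have discrete: "X \<in> sets ?PM" if "X \<subseteq> PiE {..<k} (\<lambda>_. \<Omega>)" for X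
  proof -
    have "X = (\<Union>h\<in>X. {h})" by blast
    also have "\<dots> \<in> sets ?PM"
      using that finPi by (intro sets.finite_UN singleton) (auto intro: finite_subset)
    finally show ?thesis .
  qed
  have F_meas: "F \<in> borel_measurable ?PM"
    by (rule measurableI) (auto intro!: discrete simp: space_PiM)
  have "indep_var ?PM ?H (PiM {k} (\<lambda>_. count_space \<Omega>)) (\<lambda>\<omega>. restrict (\<lambda>j. B j \<omega>) {k})"
    by (rule indep_var_restrict[OF indep]) auto
  then have "indep_var borel (F \<circ> ?H) borel ((\<lambda>h. indicator {S} (h k) :: real) \<circ> (\<lambda>\<omega>. restrict (\<lambda>j. B j \<omega>) {k}))"
  proof (rule indep_var_compose[OF _ F_meas])
    have "(\<lambda>h. h k) \<in> measurable (PiM {k} (\<lambda>_. count_space \<Omega>)) (count_space \<Omega>)"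
      by (rule measurable_component_singleton) simp
    then show "(\<lambda>h. indicator {S} (h k) :: real) \<in> borel_measurable (PiM {k} (\<lambda>_. count_space \<Omega>))"
      by (rule measurable_compose) simp
  qed
  moreover have "F \<circ> ?H = (\<lambda>\<omega>. F (\<lambda>j. B j \<omega>))"
    by (auto simp: fun_eq_iff intro!: local)
  ultimately have ind: "indep_var borel (\<lambda>\<omega>. F (\<lambda>j. B j \<omega>)) borel (\<lambda>\<omega>. indicator {S} (B k \<omega>) :: real)"
    by (simp add: comp_def)
  have H_in: "?H \<omega> \<in> PiE {..<k} (\<lambda>_. \<Omega>)" if "\<omega> \<in> space M" for \<omega>
  proof -
    have "B j \<in> measurable M (count_space \<Omega>)" for j using indep by (simp add: indep_vars_def)
    from measurable_space[OF this that] show ?thesis by simp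
  qed
  show int: "integrable M (\<lambda>\<omega>. F (\<lambda>j. B j \<omega>))"
  proof (rule integrable_const_bound[where B = "Max ((\<lambda>h. \<bar>F h\<bar>) ` PiE {..<k} (\<lambda>_. \<Omega>))"])
    have "\<bar>F (\<lambda>j. B j \<omega>)\<bar> \<le> Max ((\<lambda>h. \<bar>F h\<bar>) ` PiE {..<k} (\<lambda>_. \<Omega>))" if "\<omega> \<in> space M" for \<omega>
    proof -
      have "F (\<lambda>j. B j \<omega>) = F (?H \<omega>)" by (rule local) simp
      then show ?thesis using H_in[OF that] finPi by (auto intro!: Max_ge)
    qed
    then show "AE \<omega> in M. norm (F (\<lambda>j. B j \<omega>)) \<le> Max ((\<lambda>h. \<bar>F h\<bar>) ` PiE {..<k} (\<lambda>_. \<Omega>))"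
      by simp
    show "(\<lambda>\<omega>. F (\<lambda>j. B j \<omega>)) \<in> borel_measurable M" using indep_var_rv1[OF ind] .
  qed
  have "integrable M (\<lambda>\<omega>. indicator {S} (B k \<omega>) :: real)"
    by (rule integrable_const_bound[where B = 1]) (use indep_var_rv2[OF ind] in \<open>auto simp: indicator_def\<close>)
  with ind int show "expectation (\<lambda>\<omega>. F (\<lambda>j. B j \<omega>) * indicator {S} (B k \<omega>))
      = expectation (\<lambda>\<omega>. F (\<lambda>j. B j \<omega>)) * expectation (\<lambda>\<omega>. indicator {S} (B k \<omega>))"
    by (rule indep_var_lebesgue_integral)
qed

lemma uniform_minibatches_mem:
  assumes "prob_space P" "uniform_minibatches P n b B" "\<omega> \<in> space P"
  shows "B k \<omega> \<in> batches n b"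
proof -
  interpret prob_space P by fact
  have "random_variable (count_space (batches n b)) (B k)"
    using assms(2) by (auto simp: uniform_minibatches_def indep_vars_def)
  from measurable_space[OF this assms(3)] show ?thesis by simp
qed

text \<open>The tower property in a form that avoids conditional expectations: averaging over the \<open>k\<close>-th batch
  by hand, with the earlier ones fixed, leaves the expectation of a functional of the first \<open>k + 1\<close>
  batches unchanged.\<close>

lemma uniform_resampling:
  fixes F :: "(nat \<Rightarrow> nat set) \<Rightarrow> real"
  assumes P: "prob_space P" and unif: "uniform_minibatches P n b B"
    and local: "\<And>s s'. (\<And>j. j < Suc k \<Longrightarrow> s j = s' j) \<Longrightarrow> F s = F s'"
  shows "integrable P (\<lambda>\<omega>. F (\<lambda>j. B j \<omega>))"
    and "real (card (batches n b)) * prob_space.expectation P (\<lambda>\<omega>. F (\<lambda>j. B j \<omega>))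
      = prob_space.expectation P (\<lambda>\<omega>. \<Sum>S\<in>batches n b. F ((\<lambda>j. B j \<omega>)(k := S)))"
proof -
  interpret prob_space P by fact
  let ?\<Omega> = "batches n b"
  have fin: "finite ?\<Omega>" by simp
  have indep: "indep_vars (\<lambda>_. count_space ?\<Omega>) B UNIV"
    and law: "distr P (count_space ?\<Omega>) (B k) = uniform_count_measure ?\<Omega>"
    using unif by (auto simp: uniform_minibatches_def)
  have rv: "random_variable (count_space ?\<Omega>) (B k)" using indep by (simp add: indep_vars_def)
  show "integrable P (\<lambda>\<omega>. F (\<lambda>j. B j \<omega>))"
    by (rule finite_history_independent_of_next(1)[OF indep fin local])
  \<comment> \<open>With the \<open>k\<close>-th batch frozen at \<open>S\<close>, the functional depends on the earlier batches only. The
    proof splits the expectation according to the value of the \<open>k\<close>-th batch and factors each part.\<close>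
  define FS where "FS S s = F (s(k := S))" for S s
  have FS_local: "FS S s = FS S s'" if "\<And>j. j < k \<Longrightarrow> s j = s' j" for S s s'
    unfolding FS_def by (rule local) (use that in auto)
  note FS = finite_history_independent_of_next[OF indep fin, of k "FS _", OF FS_local]
  have FS_int: "integrable P (\<lambda>\<omega>. FS S (\<lambda>j. B j \<omega>))" for S
    by (rule FS(1)) simp
  have FS_ind: "expectation (\<lambda>\<omega>. FS S (\<lambda>j. B j \<omega>) * indicator {S} (B k \<omega>))
      = expectation (\<lambda>\<omega>. FS S (\<lambda>j. B j \<omega>)) * expectation (\<lambda>\<omega>. indicator {S} (B k \<omega>))" for S
    by (rule FS(2)) simp
  have mass: "expectation (\<lambda>\<omega>. indicator {S} (B k \<omega>) :: real) = 1 / real (card ?\<Omega>)" if "S \<in> ?\<Omega>" for S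
  proof -
    have "expectation (\<lambda>\<omega>. indicator {S} (B k \<omega>) :: real)
        = integral\<^sup>L (distr P (count_space ?\<Omega>) (B k)) (indicator {S})"
      by (rule integral_distr[symmetric, OF rv]) simp
    also have "\<dots> = 1 / real (card ?\<Omega>)"
      using that fin by (simp add: law measure_uniform_count_measure)
    finally show ?thesis .
  qed
  have prod_int: "integrable P (\<lambda>\<omega>. FS S (\<lambda>j. B j \<omega>) * indicator {S} (B k \<omega>))" for S
  proof -
    have "(\<lambda>\<omega>. indicator {S} (B k \<omega>) :: real) \<in> borel_measurable P"
      by (rule measurable_compose[OF rv]) simp
    then show ?thesis
      by (intro Bochner_Integration.integrable_bound[OF FS_int[of S]] borel_measurable_times
          borel_measurable_integrable[OF FS_int]) (auto simp: indicator_def)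
  qed
  have "expectation (\<lambda>\<omega>. F (\<lambda>j. B j \<omega>))
      = expectation (\<lambda>\<omega>. \<Sum>S\<in>?\<Omega>. FS S (\<lambda>j. B j \<omega>) * indicator {S} (B k \<omega>))"
  proof (rule Bochner_Integration.integral_cong[OF refl])
    fix \<omega> assume "\<omega> \<in> space P"
    then have "B k \<omega> \<in> ?\<Omega>" by (rule uniform_minibatches_mem[OF P unif])
    then have "(\<Sum>S\<in>?\<Omega>. FS S (\<lambda>j. B j \<omega>) * indicator {S} (B k \<omega>)) = FS (B k \<omega>) (\<lambda>j. B j \<omega>)"
      using fin by (simp add: indicator_def if_distrib cong: if_cong)
    also have "\<dots> = F (\<lambda>j. B j \<omega>)"
    proof -
      have "(\<lambda>j. B j \<omega>)(k := B k \<omega>) = (\<lambda>j. B j \<omega>)" by auto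
      then show ?thesis by (simp only: FS_def)
    qed
    finally show "F (\<lambda>j. B j \<omega>) = (\<Sum>S\<in>?\<Omega>. FS S (\<lambda>j. B j \<omega>) * indicator {S} (B k \<omega>))" by simp
  qed
  also have "\<dots> = (\<Sum>S\<in>?\<Omega>. expectation (\<lambda>\<omega>. FS S (\<lambda>j. B j \<omega>) * indicator {S} (B k \<omega>)))"
    by (rule Bochner_Integration.integral_sum) (rule prod_int)
  also have "\<dots> = (\<Sum>S\<in>?\<Omega>. expectation (\<lambda>\<omega>. FS S (\<lambda>j. B j \<omega>)) * (1 / real (card ?\<Omega>)))"
    by (intro sum.cong refl) (simp only: FS_ind mass)
  also have "\<dots> = expectation (\<lambda>\<omega>. \<Sum>S\<in>?\<Omega>. FS S (\<lambda>j. B j \<omega>)) / real (card ?\<Omega>)"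
    by (simp add: Bochner_Integration.integral_sum[OF FS_int] sum_divide_distrib)
  finally have E: "expectation (\<lambda>\<omega>. F (\<lambda>j. B j \<omega>))
      = expectation (\<lambda>\<omega>. \<Sum>S\<in>?\<Omega>. FS S (\<lambda>j. B j \<omega>)) / real (card ?\<Omega>)" .
  obtain \<omega> where "\<omega> \<in> space P" using not_empty by blast
  then have "?\<Omega> \<noteq> {}" using uniform_minibatches_mem[OF P unif] by blast
  then show "real (card ?\<Omega>) * expectation (\<lambda>\<omega>. F (\<lambda>j. B j \<omega>))
      = expectation (\<lambda>\<omega>. \<Sum>S\<in>?\<Omega>. F ((\<lambda>j. B j \<omega>)(k := S)))"
    using fin by (simp add: E FS_def)
qed

section \<open>The method as a Markov chain\<close>

text \<open>The next step depends on the past only through the current iterate, the previous iterate and the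
  table. With these as state, the method is a chain driven by independent batches.\<close>

definition saga_next ::
  "nat \<Rightarrow> nat \<Rightarrow> (nat \<Rightarrow> 'v::real_vector \<Rightarrow> 'v) \<Rightarrow> real \<Rightarrow> real \<Rightarrow> nat set
    \<Rightarrow> 'v \<times> 'v \<times> (nat \<Rightarrow> 'v) \<Rightarrow> 'v \<times> 'v \<times> (nat \<Rightarrow> 'v)" where
  "saga_next n b G \<gamma> \<eta> S = (\<lambda>(y, z, T).
     (y - \<eta> *\<^sub>R (avg b S (\<lambda>i. G i y) - \<gamma> *\<^sub>R avg b S (\<lambda>i. G i z) - (1 - \<gamma>) *\<^sub>R avg b S T
          + (1 - \<gamma>) *\<^sub>R avg n {1..n} T),
      y, \<lambda>i. if i \<in> S then G i y else T i))"

primrec saga_state ::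
  "nat \<Rightarrow> nat \<Rightarrow> (nat \<Rightarrow> 'v::real_vector \<Rightarrow> 'v) \<Rightarrow> real \<Rightarrow> real \<Rightarrow> 'v \<Rightarrow> (nat \<Rightarrow> nat set) \<Rightarrow> nat
    \<Rightarrow> 'v \<times> 'v \<times> (nat \<Rightarrow> 'v)" where
  "saga_state n b G \<gamma> \<eta> x0 s 0 = (x0, x0, \<lambda>i. G i x0)"
| "saga_state n b G \<gamma> \<eta> x0 s (Suc k) = saga_next n b G \<gamma> \<eta> (s k) (saga_state n b G \<gamma> \<eta> x0 s k)"

lemma saga_state_eq_iterates:
  assumes "saga_iterates n b G \<gamma> \<eta> x0 s x"
  shows "saga_state n b G \<gamma> \<eta> x0 s k = (x k, x (k - 1), saga_table G s x k)"
proof (induction k)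
  case (Suc k)
  then show ?case
    using assms by (simp add: saga_iterates_def saga_next_def saga_estimator_def)
qed (use assms in \<open>simp add: saga_iterates_def\<close>)

text \<open>Causality: the state at time \<open>k\<close> is determined by the batches with index below \<open>k\<close>. This makes it
  independent of the batch drawn at time \<open>k\<close>.\<close>

lemma saga_state_cong:
  assumes "\<And>j. j < k \<Longrightarrow> s j = s' j"
  shows "saga_state n b G \<gamma> \<eta> x0 s k = saga_state n b G \<gamma> \<eta> x0 s' k"
  using assms by (induction k) auto

section \<open>One step of the method\<close>

lemma avg_diff: "avg m I (\<lambda>i. u i - w i) = avg m I u - avg m I w"
  by (simp add: avg_def sum_subtractf scaleR_diff_right)

lemma avg_scaleR: "avg m I (\<lambda>i. c *\<^sub>R u i) = c *\<^sub>R avg m I u"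
  by (simp add: avg_def mult.commute flip: scaleR_sum_right)

lemma norm_sq_diff_scaleR:
  fixes u w :: "'v::real_inner"
  shows "(norm (u - c *\<^sub>R w))\<^sup>2 = (norm u)\<^sup>2 - 2 * c * (w \<bullet> u) + c\<^sup>2 * (norm w)\<^sup>2"
  unfolding power2_norm_eq_inner
  by (simp add: inner_diff inner_commute power2_eq_square algebra_simps)

lemma sum_norm_sq_shift:
  fixes e :: "'a \<Rightarrow> 'v::real_inner"
  assumes "(\<Sum>S\<in>A. e S) = 0"
  shows "(\<Sum>S\<in>A. (norm (a - c *\<^sub>R e S))\<^sup>2) = real (card A) * (norm a)\<^sup>2 + c\<^sup>2 * (\<Sum>S\<in>A. (norm (e S))\<^sup>2)"
proof -
  have "(\<Sum>S\<in>A. e S \<bullet> a) = 0" using assms by (simp flip: inner_sum_left)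
  then show ?thesis
    by (simp add: norm_sq_diff_scaleR sum.distrib sum_subtractf flip: sum_distrib_left)
qed

lemma norm_sq_add_le:
  fixes u w :: "'v::real_inner"
  assumes "0 < c"
  shows "(norm (u + w))\<^sup>2 \<le> (1 + c) * (norm u)\<^sup>2 + (1 + 1 / c) * (norm w)\<^sup>2"
proof -
  have "0 \<le> (norm (sqrt c *\<^sub>R u - (1 / sqrt c) *\<^sub>R w))\<^sup>2" by simp
  also have "\<dots> = c * (norm u)\<^sup>2 - 2 * (u \<bullet> w) + (1 / c) * (norm w)\<^sup>2"
    using assms by (simp add: power2_norm_eq_inner inner_diff inner_commute field_simps)
  finally show ?thesis
    by (simp add: power2_norm_eq_inner inner_add inner_commute algebra_simps)
qed

lemma norm_sq_convex_combination:
  fixes u w :: "'v::real_inner"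
  assumes "0 \<le> c" "c \<le> 1"
  shows "(norm ((1 - c) *\<^sub>R u + c *\<^sub>R w))\<^sup>2 \<le> (1 - c) * (norm u)\<^sup>2 + c * (norm w)\<^sup>2"
proof -
  have "(1 - c) * (norm u)\<^sup>2 + c * (norm w)\<^sup>2 - (norm ((1 - c) *\<^sub>R u + c *\<^sub>R w))\<^sup>2
      = c * (1 - c) * (norm (u - w))\<^sup>2"
    unfolding power2_norm_eq_inner
    by (simp add: inner_diff inner_add inner_commute algebra_simps power2_eq_square)
  then show ?thesis using assms
    by (metis diff_ge_0_iff_ge mult_nonneg_nonneg zero_le_power2)
qed

lemma norm_sq_diff_scaled:
  fixes u w :: "'v::real_inner"
  shows "(norm (u - c *\<^sub>R w))\<^sup>2 = (1 - c) * (norm u)\<^sup>2 - c * (1 - c) * (norm w)\<^sup>2 + c * (norm (u - w))\<^sup>2"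
  unfolding power2_norm_eq_inner
  by (simp add: inner_diff inner_commute algebra_simps power2_eq_square)

text \<open>The bound on \<open>\<kappa>\<close> and the step size condition are the forms in which the two smallness assumptions
  enter the analysis; for \<open>\<eta> = saga_eta n b \<gamma> L\<close> the latter is an equality.\<close>

locale saga =
  fixes G :: "nat \<Rightarrow> 'v::real_inner \<Rightarrow> 'v" and n b :: nat and L \<gamma> \<eta> \<kappa> :: real and xstar :: 'v
  assumes b_ge: "1 \<le> b" and b_le: "b \<le> n"
    and L_pos: "0 < L" and eta_pos: "0 < \<eta>"
    and gamma: "1 / 2 < \<gamma>" "\<gamma> < 1"
    and lipschitz: "\<And>y z. (1 / real n) * (\<Sum>i=1..n. (norm (G i y - G i z))\<^sup>2) \<le> L\<^sup>2 * (norm (y - z))\<^sup>2"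
    and xstar: "mean_op n G xstar = 0"
    and weak_minty: "\<And>z. mean_op n G z \<bullet> (z - xstar) \<ge> - \<kappa> * (norm (mean_op n G z))\<^sup>2"
    and kappa: "8 * \<kappa> \<le> (2 * \<gamma> - 1) * \<eta>"
    and stepsize: "L\<^sup>2 * \<eta>\<^sup>2 * saga_M n b \<gamma> \<le> 1"
begin

abbreviation "Gm \<equiv> mean_op n G"
abbreviation "step \<equiv> saga_next n b G \<gamma> \<eta>"
abbreviation "N \<equiv> real (card (batches n b))"

definition staleness :: "'v \<Rightarrow> (nat \<Rightarrow> 'v) \<Rightarrow> real" where
  "staleness y T = (1 / real n) * (\<Sum>i=1..n. (norm (G i y - T i))\<^sup>2)"

definition noise :: "'v \<times> 'v \<times> (nat \<Rightarrow> 'v) \<Rightarrow> nat set \<Rightarrow> 'v" where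
  "noise = (\<lambda>(y, z, T) S. avg b S (\<lambda>i. G i y - \<gamma> *\<^sub>R G i z - (1 - \<gamma>) *\<^sub>R T i)
     - avg n {1..n} (\<lambda>i. G i y - \<gamma> *\<^sub>R G i z - (1 - \<gamma>) *\<^sub>R T i))"

text \<open>The probability that a given index is sampled.\<close>

definition p :: real where "p = real b / real n"

text \<open>The weights of the potential. The multiple of \<open>\<parallel>g k\<parallel>\<^sup>2\<close> that \<open>anchor_step\<close> leaves over is
  \<open>\<beta> (1 - \<gamma>) \<eta>\<^sup>2\<close>, and the next displacement costs \<open>(1 - \<gamma>) \<eta>\<^sup>2 \<parallel>g k\<parallel>\<^sup>2\<close> per
  unit of weight, so \<open>\<beta>\<close> is the total weight that the next displacement may carry. It is split between \<open>\<alpha>\<close> and the feedback of the displacement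
  into the staleness. The weight \<open>\<tau>\<close> is the one for which the contraction of the staleness pays
  exactly for its contribution to the noise.\<close>

definition \<beta> :: real where "\<beta> = 3 / 4 * (2 * \<gamma> - 1)"
definition \<tau> :: real where "\<tau> = 2 / p * ((1 + \<beta>) * \<eta>\<^sup>2 * (1 - \<gamma>) / real b)"
definition \<alpha> :: real where "\<alpha> = \<beta> - \<tau> * ((2 - p) / p) * L\<^sup>2"

definition potential :: "'v \<times> 'v \<times> (nat \<Rightarrow> 'v) \<Rightarrow> real" where
  "potential = (\<lambda>(y, z, T). (norm (y + (\<gamma> * \<eta>) *\<^sub>R Gm z - xstar))\<^sup>2
     + \<alpha> * (norm (y - z))\<^sup>2 + \<tau> * staleness y T)"

lemma n_pos: "0 < n" and p_pos: "0 < p" and p_le: "p \<le> 1" and N_pos: "0 < N"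
  using b_ge b_le card_batches_pos[OF b_le] by (auto simp: p_def)

lemma mean_lipschitz: "(norm (Gm y - Gm z))\<^sup>2 \<le> L\<^sup>2 * (norm (y - z))\<^sup>2"
proof -
  have "Gm y - Gm z = avg n {1..n} (\<lambda>i. G i y - G i z)"
    by (simp add: mean_op_def avg_def sum_subtractf scaleR_diff_right)
  then show ?thesis using norm_avg_sq_le[of n "\<lambda>i. G i y - G i z"] lipschitz[of y z] by simp
qed

lemma step_eq:
  "step S (y, z, T) = (y - \<eta> *\<^sub>R (Gm y - \<gamma> *\<^sub>R Gm z) - \<eta> *\<^sub>R noise (y, z, T) S,
     y, \<lambda>i. if i \<in> S then G i y else T i)"
proof -
  define c where "c = 1 - \<gamma>"
  show ?thesis
    unfolding saga_next_def noise_def mean_op_def c_def[symmetric] split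
    by (simp only: avg_diff avg_scaleR) (simp add: algebra_simps)
qed

lemma noise_unbiased: "(\<Sum>S\<in>batches n b. noise st S) = 0"
  using batch_avg_unbiased[OF b_ge b_le] by (cases st) (simp add: noise_def)

text \<open>The averaged vectors are \<open>(1 - \<gamma>) (G i y - T i) + \<gamma> (G i y - G i z)\<close>. Convexity of the squared norm
  keeps the weights \<open>1 - \<gamma>\<close> and \<open>\<gamma>\<close>, where Young's inequality would cost a factor.\<close>

lemma noise_variance:
  "(\<Sum>S\<in>batches n b. (norm (noise (y, z, T) S))\<^sup>2)
    \<le> N * ((1 / real b) * ((1 - \<gamma>) * staleness y T + \<gamma> * L\<^sup>2 * (norm (y - z))\<^sup>2))"
proof -
  let ?v = "\<lambda>i. G i y - \<gamma> *\<^sub>R G i z - (1 - \<gamma>) *\<^sub>R T i"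
  have "(norm (?v i))\<^sup>2 \<le> (1 - \<gamma>) * (norm (G i y - T i))\<^sup>2 + \<gamma> * (norm (G i y - G i z))\<^sup>2" for i
    using norm_sq_convex_combination[of \<gamma> "G i y - T i" "G i y - G i z"] gamma
    by (simp add: algebra_simps)
  then have "(\<Sum>i=1..n. (norm (?v i))\<^sup>2)
      \<le> (\<Sum>i=1..n. (1 - \<gamma>) * (norm (G i y - T i))\<^sup>2 + \<gamma> * (norm (G i y - G i z))\<^sup>2)"
    by (intro sum_mono)
  then have "(1 / real n) * (\<Sum>i=1..n. (norm (?v i))\<^sup>2)
      \<le> (1 / real n) * (\<Sum>i=1..n. (1 - \<gamma>) * (norm (G i y - T i))\<^sup>2 + \<gamma> * (norm (G i y - G i z))\<^sup>2)"
    by (intro mult_left_mono) auto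
  also have "\<dots> = (1 - \<gamma>) * staleness y T + \<gamma> * ((1 / real n) * (\<Sum>i=1..n. (norm (G i y - G i z))\<^sup>2))"
    by (simp add: staleness_def sum.distrib add_divide_distrib flip: sum_distrib_left)
  also have "\<dots> \<le> (1 - \<gamma>) * staleness y T + \<gamma> * (L\<^sup>2 * (norm (y - z))\<^sup>2)"
    using lipschitz gamma by (intro add_left_mono mult_left_mono) auto
  finally have 1: "(1 / real n) * (\<Sum>i=1..n. (norm (?v i))\<^sup>2)
      \<le> (1 - \<gamma>) * staleness y T + \<gamma> * L\<^sup>2 * (norm (y - z))\<^sup>2" by simp
  have "(\<Sum>S\<in>batches n b. (norm (noise (y, z, T) S))\<^sup>2)
      \<le> N * ((1 / real b) * ((1 / real n) * (\<Sum>i=1..n. (norm (?v i))\<^sup>2)))"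
    using batch_avg_variance[OF b_ge b_le, of ?v] by (simp add: noise_def)
  also have "\<dots> \<le> N * ((1 / real b) * ((1 - \<gamma>) * staleness y T + \<gamma> * L\<^sup>2 * (norm (y - z))\<^sup>2))"
    by (intro mult_left_mono 1) auto
  finally show ?thesis .
qed

lemma displacement:
  "(\<Sum>S\<in>batches n b. (norm (fst (step S (y, z, T)) - y))\<^sup>2)
    \<le> N * (\<eta>\<^sup>2 * ((1 - \<gamma>) * (norm (Gm y))\<^sup>2 + \<gamma> * L\<^sup>2 * (norm (y - z))\<^sup>2))
      + \<eta>\<^sup>2 * (\<Sum>S\<in>batches n b. (norm (noise (y, z, T) S))\<^sup>2)"
proof -
  have "(norm (Gm y - \<gamma> *\<^sub>R Gm z))\<^sup>2 \<le> (1 - \<gamma>) * (norm (Gm y))\<^sup>2 + \<gamma> * (norm (Gm y - Gm z))\<^sup>2"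
    using gamma by (simp add: norm_sq_diff_scaled)
  also have "\<dots> \<le> (1 - \<gamma>) * (norm (Gm y))\<^sup>2 + \<gamma> * L\<^sup>2 * (norm (y - z))\<^sup>2"
    using mean_lipschitz[of y z] gamma by (simp add: mult.assoc)
  finally have 1: "(norm (Gm y - \<gamma> *\<^sub>R Gm z))\<^sup>2 \<le> (1 - \<gamma>) * (norm (Gm y))\<^sup>2 + \<gamma> * L\<^sup>2 * (norm (y - z))\<^sup>2" .
  have "(\<Sum>S\<in>batches n b. (norm (fst (step S (y, z, T)) - y))\<^sup>2)
      = (\<Sum>S\<in>batches n b. (norm (- (\<eta> *\<^sub>R (Gm y - \<gamma> *\<^sub>R Gm z)) - \<eta> *\<^sub>R noise (y, z, T) S))\<^sup>2)"
    by (simp add: step_eq)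
  also have "\<dots> = N * (\<eta>\<^sup>2 * (norm (Gm y - \<gamma> *\<^sub>R Gm z))\<^sup>2)
      + \<eta>\<^sup>2 * (\<Sum>S\<in>batches n b. (norm (noise (y, z, T) S))\<^sup>2)"
    by (simp add: sum_norm_sq_shift[OF noise_unbiased] power_mult_distrib)
  finally show ?thesis using 1 by (simp add: mult_left_mono)
qed

text \<open>A refreshed entry is off only by the change of \<open>G i\<close> over the step; an entry that is kept is off by
  the old error plus this change. Young's inequality with parameter \<open>p / (2 (1 - p))\<close> turns the
  survival factor \<open>1 - p\<close> into \<open>1 - p / 2\<close>. For \<open>p = 1\<close> every entry is refreshed.\<close>

lemma staleness_step:
  "(\<Sum>S\<in>batches n b. staleness (fst (step S (y, z, T))) (snd (snd (step S (y, z, T)))))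
    \<le> N * ((1 - p / 2) * staleness y T)
      + (2 - p) / p * L\<^sup>2 * (\<Sum>S\<in>batches n b. (norm (fst (step S (y, z, T)) - y))\<^sup>2)"
proof -
  let ?y = "\<lambda>S. fst (step S (y, z, T))" and ?T = "\<lambda>S i. if i \<in> S then G i y else T i"
  let ?c = "(2 - p) / p"
  let ?q = "\<lambda>i S. if i \<in> S then 0 else (if p = 1 then 0 else (1 - p / 2) / (1 - p)) * (norm (G i y - T i))\<^sup>2"
  \<comment> \<open>\<open>?q i S\<close> is the part of the new error of entry \<open>i\<close> that is inherited from the old table. Entries
    are kept only when \<open>p < 1\<close>, and the value \<open>0\<close> at \<open>p = 1\<close> makes \<open>count\<close> hold there as well.\<close>
  have c_ge: "1 \<le> ?c" using p_pos p_le by (simp add: field_simps)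
  have entry: "(norm (G i (?y S) - ?T S i))\<^sup>2 \<le> ?q i S + ?c * (norm (G i (?y S) - G i y))\<^sup>2"
    if "S \<in> batches n b" "i \<in> {1..n}" for S i
  proof (cases "i \<in> S")
    case True
    then show ?thesis using c_ge mult_right_mono[of 1 ?c "(norm (G i (?y S) - G i y))\<^sup>2"] by simp
  next
    case False
    have "b < n"
    proof -
      have "S \<subset> {1..n}" using that False by (auto simp: batches_def)
      then have "card S < card {1..n}" by (intro psubset_card_mono) auto
      then show ?thesis using that by (simp add: batches_def)
    qed
    then have p_less: "p < 1" using n_pos by (simp add: p_def)
    have "(norm ((G i y - T i) + (G i (?y S) - G i y)))\<^sup>2
        \<le> (1 + p / (2 * (1 - p))) * (norm (G i y - T i))\<^sup>2
          + (1 + 1 / (p / (2 * (1 - p)))) * (norm (G i (?y S) - G i y))\<^sup>2"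
      using p_pos p_less by (intro norm_sq_add_le) auto
    also have "1 + p / (2 * (1 - p)) = (1 - p / 2) / (1 - p)"
      using p_less by (simp add: field_simps)
    also have "1 + 1 / (p / (2 * (1 - p))) = ?c" using p_pos by (simp add: field_simps)
    finally show ?thesis using False p_less by simp
  qed
  have count: "(\<Sum>S\<in>batches n b. ?q i S) \<le> N * ((1 - p / 2) * (norm (G i y - T i))\<^sup>2)" if "i \<in> {1..n}" for i
  proof -
    let ?w = "if p = 1 then 0 else (1 - p / 2) / (1 - p)"
    have "(\<Sum>S\<in>batches n b. if i \<in> S then (1::real) else 0) = p * N"
      using card_batches_containing_elem[OF b_ge b_le that] by (simp add: p_def flip: sum.inter_filter)
    moreover have "?q i S = ?w * (norm (G i y - T i))\<^sup>2 * (1 - (if i \<in> S then 1 else 0))" for S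
      by simp
    ultimately have "(\<Sum>S\<in>batches n b. ?q i S) = ?w * (norm (G i y - T i))\<^sup>2 * (N - p * N)"
      by (simp only: sum_subtractf flip: sum_distrib_left) simp
    also have "\<dots> = (?w * (1 - p)) * (N * (norm (G i y - T i))\<^sup>2)" by (simp add: algebra_simps)
    also have "\<dots> \<le> (1 - p / 2) * (N * (norm (G i y - T i))\<^sup>2)"
      using p_le by (intro mult_right_mono) auto
    finally show ?thesis by (simp add: algebra_simps)
  qed
  have "(\<Sum>S\<in>batches n b. staleness (?y S) (snd (snd (step S (y, z, T)))))
      = (1 / real n) * (\<Sum>S\<in>batches n b. \<Sum>i=1..n. (norm (G i (?y S) - ?T S i))\<^sup>2)"
    by (simp add: staleness_def step_eq sum_divide_distrib)
  also have "\<dots> \<le> (1 / real n) * (\<Sum>S\<in>batches n b. \<Sum>i=1..n. ?q i S + ?c * (norm (G i (?y S) - G i y))\<^sup>2)"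
    by (intro mult_left_mono sum_mono entry) auto
  also have "\<dots> = (1 / real n) * (\<Sum>S\<in>batches n b. \<Sum>i=1..n. ?q i S)
      + (1 / real n) * (\<Sum>S\<in>batches n b. \<Sum>i=1..n. ?c * (norm (G i (?y S) - G i y))\<^sup>2)"
    by (simp only: sum.distrib distrib_left)
  also have "(\<Sum>S\<in>batches n b. \<Sum>i=1..n. ?q i S) = (\<Sum>i=1..n. \<Sum>S\<in>batches n b. ?q i S)"
    by (rule sum.swap)
  also have "(1 / real n) * (\<Sum>S\<in>batches n b. \<Sum>i=1..n. ?c * (norm (G i (?y S) - G i y))\<^sup>2)
      = ?c * (\<Sum>S\<in>batches n b. (1 / real n) * (\<Sum>i=1..n. (norm (G i (?y S) - G i y))\<^sup>2))"
    by (simp only: sum_distrib_left mult.left_commute)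
  also have "(1 / real n) * (\<Sum>i=1..n. \<Sum>S\<in>batches n b. ?q i S)
      + ?c * (\<Sum>S\<in>batches n b. (1 / real n) * (\<Sum>i=1..n. (norm (G i (?y S) - G i y))\<^sup>2)) \<le> (1 / real n) * (\<Sum>i=1..n. N * ((1 - p / 2) * (norm (G i y - T i))\<^sup>2))
      + ?c * (\<Sum>S\<in>batches n b. L\<^sup>2 * (norm (?y S - y))\<^sup>2)"
    using c_ge by (intro add_mono mult_left_mono sum_mono count lipschitz) auto
  also have "\<dots> = N * ((1 - p / 2) * staleness y T) + ?c * L\<^sup>2 * (\<Sum>S\<in>batches n b. (norm (?y S - y))\<^sup>2)"
    unfolding staleness_def by (simp only: sum_distrib_left mult_ac)
  finally show ?thesis .
qed

text \<open>The quantities stand for \<open>X\<close>: the squared distance after the mean step, \<open>A\<close>: before it,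
  \<open>g\<close>, \<open>h\<close>, \<open>d\<close>: the squared norms of \<open>Gm y\<close>, \<open>Gm z\<close> and of their difference, and \<open>ip\<close>: the inner
  product of \<open>Gm y\<close> with the shifted error.\<close>

lemma anchor_arithmetic:
  fixes X A g h d ip :: real
  assumes "2 * (1 - \<gamma>) * \<eta> * (- ((2 * \<gamma> - 1) * \<eta> / 8 * g) + \<gamma> * \<eta> / 2 * (g + h - d))
      \<le> 2 * (1 - \<gamma>) * \<eta> * ip"
    and "X = A - 2 * (1 - \<gamma>) * \<eta> * ip + (1 - \<gamma>)\<^sup>2 * \<eta>\<^sup>2 * g"
  shows "X \<le> A - \<beta> * (1 - \<gamma>) * \<eta>\<^sup>2 * g - \<gamma> * (1 - \<gamma>) * \<eta>\<^sup>2 * h + \<gamma> * (1 - \<gamma>) * \<eta>\<^sup>2 * d"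
proof -
  have "A - 2 * (1 - \<gamma>) * \<eta> * (- ((2 * \<gamma> - 1) * \<eta> / 8 * g) + \<gamma> * \<eta> / 2 * (g + h - d))
        + (1 - \<gamma>)\<^sup>2 * \<eta>\<^sup>2 * g
      = A - \<beta> * (1 - \<gamma>) * \<eta>\<^sup>2 * g - \<gamma> * (1 - \<gamma>) * \<eta>\<^sup>2 * h + \<gamma> * (1 - \<gamma>) * \<eta>\<^sup>2 * d"
    by (simp add: \<beta>_def power2_eq_square field_simps)
  with assms show ?thesis by linarith
qed

text \<open>The shift by \<open>\<gamma> \<eta> Gm z\<close> cancels the reflection, so the mean step is \<open>- (1 - \<gamma>) \<eta> Gm y\<close>. In its inner
  product with the shifted error, the weak Minty inequality bounds the part from \<open>y - xstar\<close>, and the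
  part \<open>\<gamma> \<eta> (Gm y \<bullet> Gm z)\<close> is polarised into squares.\<close>

lemma anchor_step:
  "(\<Sum>S\<in>batches n b. (norm (fst (step S (y, z, T)) + (\<gamma> * \<eta>) *\<^sub>R Gm y - xstar))\<^sup>2)
    \<le> N * ((norm (y + (\<gamma> * \<eta>) *\<^sub>R Gm z - xstar))\<^sup>2
          - \<beta> * (1 - \<gamma>) * \<eta>\<^sup>2 * (norm (Gm y))\<^sup>2
          - \<gamma> * (1 - \<gamma>) * \<eta>\<^sup>2 * (norm (Gm z))\<^sup>2
          + \<gamma> * (1 - \<gamma>) * \<eta>\<^sup>2 * L\<^sup>2 * (norm (y - z))\<^sup>2)
      + \<eta>\<^sup>2 * (\<Sum>S\<in>batches n b. (norm (noise (y, z, T) S))\<^sup>2)"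
proof -
  let ?a = "y + (\<gamma> * \<eta>) *\<^sub>R Gm z - xstar" and ?g = "(norm (Gm y))\<^sup>2" and ?h = "(norm (Gm z))\<^sup>2"
  let ?d = "(norm (Gm y - Gm z))\<^sup>2"
  have cross: "2 * (Gm y \<bullet> Gm z) = ?g + ?h - ?d"
    by (simp add: power2_norm_eq_inner inner_diff inner_commute)
  have "Gm y \<bullet> ?a = Gm y \<bullet> (y - xstar) + \<gamma> * \<eta> * (Gm y \<bullet> Gm z)"
    by (simp add: inner_diff inner_add algebra_simps)
  also have "\<dots> \<ge> - \<kappa> * ?g + \<gamma> * \<eta> / 2 * (?g + ?h - ?d)"
    using weak_minty[of y] by (simp flip: cross)
  finally have inner: "- \<kappa> * ?g + \<gamma> * \<eta> / 2 * (?g + ?h - ?d) \<le> Gm y \<bullet> ?a" .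
  have "\<kappa> * ?g \<le> (2 * \<gamma> - 1) * \<eta> / 8 * ?g" using kappa by (intro mult_right_mono) auto
  with inner have "- ((2 * \<gamma> - 1) * \<eta> / 8 * ?g) + \<gamma> * \<eta> / 2 * (?g + ?h - ?d) \<le> Gm y \<bullet> ?a" by linarith
  then have "2 * (1 - \<gamma>) * \<eta> * (- ((2 * \<gamma> - 1) * \<eta> / 8 * ?g) + \<gamma> * \<eta> / 2 * (?g + ?h - ?d))
      \<le> 2 * (1 - \<gamma>) * \<eta> * (Gm y \<bullet> ?a)"
    using gamma eta_pos by (intro mult_left_mono) auto
  moreover have "(norm (?a - ((1 - \<gamma>) * \<eta>) *\<^sub>R Gm y))\<^sup>2
      = (norm ?a)\<^sup>2 - 2 * (1 - \<gamma>) * \<eta> * (Gm y \<bullet> ?a) + (1 - \<gamma>)\<^sup>2 * \<eta>\<^sup>2 * ?g"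
    by (simp only: norm_sq_diff_scaleR power_mult_distrib mult.assoc)
  ultimately have "(norm (?a - ((1 - \<gamma>) * \<eta>) *\<^sub>R Gm y))\<^sup>2
      \<le> (norm ?a)\<^sup>2 - \<beta> * (1 - \<gamma>) * \<eta>\<^sup>2 * ?g - \<gamma> * (1 - \<gamma>) * \<eta>\<^sup>2 * ?h + \<gamma> * (1 - \<gamma>) * \<eta>\<^sup>2 * ?d"
    using anchor_arithmetic by blast
  also have "\<gamma> * (1 - \<gamma>) * \<eta>\<^sup>2 * ?d \<le> \<gamma> * (1 - \<gamma>) * \<eta>\<^sup>2 * (L\<^sup>2 * (norm (y - z))\<^sup>2)"
    using gamma by (intro mult_left_mono mean_lipschitz) auto
  finally have 1: "(norm (?a - ((1 - \<gamma>) * \<eta>) *\<^sub>R Gm y))\<^sup>2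
      \<le> (norm ?a)\<^sup>2 - \<beta> * (1 - \<gamma>) * \<eta>\<^sup>2 * ?g - \<gamma> * (1 - \<gamma>) * \<eta>\<^sup>2 * ?h
        + \<gamma> * (1 - \<gamma>) * \<eta>\<^sup>2 * L\<^sup>2 * (norm (y - z))\<^sup>2"
    by (simp add: mult.assoc)
  have "fst (step S (y, z, T)) + (\<gamma> * \<eta>) *\<^sub>R Gm y - xstar
      = (?a - ((1 - \<gamma>) * \<eta>) *\<^sub>R Gm y) - \<eta> *\<^sub>R noise (y, z, T) S" for S
    by (simp add: step_eq algebra_simps)
  then have "(\<Sum>S\<in>batches n b. (norm (fst (step S (y, z, T)) + (\<gamma> * \<eta>) *\<^sub>R Gm y - xstar))\<^sup>2)
      = N * (norm (?a - ((1 - \<gamma>) * \<eta>) *\<^sub>R Gm y))\<^sup>2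
        + \<eta>\<^sup>2 * (\<Sum>S\<in>batches n b. (norm (noise (y, z, T) S))\<^sup>2)"
    by (simp only: sum_norm_sq_shift[OF noise_unbiased])
  also have "\<dots> \<le> N * ((norm ?a)\<^sup>2 - \<beta> * (1 - \<gamma>) * \<eta>\<^sup>2 * ?g - \<gamma> * (1 - \<gamma>) * \<eta>\<^sup>2 * ?h
        + \<gamma> * (1 - \<gamma>) * \<eta>\<^sup>2 * L\<^sup>2 * (norm (y - z))\<^sup>2)
        + \<eta>\<^sup>2 * (\<Sum>S\<in>batches n b. (norm (noise (y, z, T) S))\<^sup>2)"
    using 1 by (intro add_right_mono mult_left_mono) auto
  finally show ?thesis .
qed

lemma beta_bounds: "0 < \<beta>" "0 \<le> \<tau>" "1 + \<beta> = (1 + 6 * \<gamma>) / 4"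
proof -
  show 1: "0 < \<beta>" and "1 + \<beta> = (1 + 6 * \<gamma>) / 4" using gamma by (simp_all add: \<beta>_def field_simps)
  show "0 \<le> \<tau>"
    unfolding \<tau>_def using 1 gamma p_pos by (intro mult_nonneg_nonneg divide_nonneg_nonneg) auto
qed

lemma staleness_nonneg: "0 \<le> staleness y T"
  by (simp add: staleness_def sum_nonneg)

text \<open>The left-hand side is the sum of all contributions of the noise to the displacement budget, per unit
  of \<open>(1 + \<beta>) \<eta>\<^sup>2 L\<^sup>2\<close>: directly, and through the staleness. With \<open>n = b + m\<close> the claim compares
  polynomials in \<open>b\<close> and \<open>m\<close> coefficientwise, using \<open>2 (1 - \<gamma>) \<le> 1\<close>.\<close>

lemma Lambda_dominates:
  "\<gamma> / real b + 2 * (2 - p) / p\<^sup>2 * (1 - \<gamma>) / real b \<le> saga_Lambda n b \<gamma>"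
proof -
  define m where "m = real n - real b"
  have m: "0 \<le> m" "real n = real b + m" using b_le by (auto simp: m_def)
  have b0: "0 < real b" "real n \<noteq> 0" using b_ge b_le by auto
  have g2: "1 / 4 \<le> \<gamma>\<^sup>2" using power_mono[of "1/2" \<gamma> 2] gamma by (simp add: power_divide)
  have "\<gamma> / real b + 2 * (2 - p) / p\<^sup>2 * (1 - \<gamma>) / real b
      = (\<gamma> * (real b)\<^sup>2 + 2 * (1 - \<gamma>) * (real n * (2 * real n - real b))) / real b ^ 3"
    using b0 by (simp add: p_def field_simps power2_eq_square power3_eq_cube)
  also have "\<dots> \<le> (2 * (real b)\<^sup>2 + 4 * (1 + \<gamma>\<^sup>2) * ((real n - real b) * (2 * real n + real b))) / real b ^ 3"
  proof (rule divide_right_mono)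
    have "\<gamma> * (real b)\<^sup>2 + 2 * (1 - \<gamma>) * (real n * (2 * real n - real b))
        = (2 - \<gamma>) * (real b)\<^sup>2 + 2 * (1 - \<gamma>) * (m * (3 * real b + 2 * m))"
      by (simp add: m(2) power2_eq_square algebra_simps)
    also have "\<dots> \<le> 2 * (real b)\<^sup>2 + 4 * (1 + \<gamma>\<^sup>2) * (m * (3 * real b + 2 * m))"
      using gamma m g2 by (intro add_mono mult_right_mono) auto
    also have "\<dots> = 2 * (real b)\<^sup>2 + 4 * (1 + \<gamma>\<^sup>2) * ((real n - real b) * (2 * real n + real b))"
      by (simp add: m(2) algebra_simps)
    finally show "\<gamma> * (real b)\<^sup>2 + 2 * (1 - \<gamma>) * (real n * (2 * real n - real b)) \<le> \<dots>" .
  qed (use b0 in simp)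
  also have "\<dots> = saga_Lambda n b \<gamma>"
    using b0 by (simp add: saga_Lambda_def add_divide_distrib power2_eq_square power3_eq_cube)
  finally show ?thesis .
qed

text \<open>The displacement terms that one step creates are covered by the weight \<open>\<alpha>\<close>. Since
  \<open>1 + \<beta> = (1 + 6 \<gamma>) / 4\<close>, the product \<open>\<beta> M\<close> is \<open>(\<gamma> (1 + 5 \<gamma>) + (1 + 6 \<gamma>) \<Lambda>) / 4\<close>, whose second part
  is exactly \<open>(1 + \<beta>) \<Lambda>\<close>.\<close>

lemma displacement_weight:
  "\<gamma> * (1 - \<gamma>) * \<eta>\<^sup>2 * L\<^sup>2 + \<beta> * \<eta>\<^sup>2 * \<gamma> * L\<^sup>2 + (1 + \<beta>) * \<eta>\<^sup>2 * \<gamma> * L\<^sup>2 / real b \<le> \<alpha>"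
proof -
  have "\<gamma> * (1 - \<gamma>) + \<beta> * \<gamma> + (1 + \<beta>) * (\<gamma> / real b + 2 * (2 - p) / p\<^sup>2 * (1 - \<gamma>) / real b)
      \<le> \<gamma> * (1 - \<gamma>) + \<beta> * \<gamma> + (1 + \<beta>) * saga_Lambda n b \<gamma>"
    using beta_bounds by (intro add_left_mono mult_left_mono Lambda_dominates) auto
  also have "\<dots> \<le> \<gamma> * (1 + 5 * \<gamma>) / 4 + (1 + 6 * \<gamma>) / 4 * saga_Lambda n b \<gamma>"
    using gamma unfolding beta_bounds(3) by (simp add: \<beta>_def field_simps)
  also have "\<dots> = \<beta> * saga_M n b \<gamma>"
  proof -
    have "A / 4 + B / 4 * C = 3 / 4 * d * (A / (3 * d) + B / (3 * d) * C)" if "d \<noteq> 0" for A B C d :: real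
      using that by (simp add: field_simps)
    moreover have "2 * \<gamma> - 1 \<noteq> 0" using gamma by simp
    ultimately show ?thesis unfolding \<beta>_def saga_M_def by blast
  qed
  finally have "\<eta>\<^sup>2 * L\<^sup>2 * (\<gamma> * (1 - \<gamma>) + \<beta> * \<gamma> + (1 + \<beta>) * (\<gamma> / real b + 2 * (2 - p) / p\<^sup>2 * (1 - \<gamma>) / real b))
      \<le> \<eta>\<^sup>2 * L\<^sup>2 * (\<beta> * saga_M n b \<gamma>)"
    by (intro mult_left_mono) auto
  also have "\<dots> \<le> \<beta>" using mult_left_mono[OF stepsize, of \<beta>] beta_bounds by (simp add: algebra_simps)
  finally have total: "\<eta>\<^sup>2 * L\<^sup>2 * (\<gamma> * (1 - \<gamma>) + \<beta> * \<gamma>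
      + (1 + \<beta>) * (\<gamma> / real b + 2 * (2 - p) / p\<^sup>2 * (1 - \<gamma>) / real b)) \<le> \<beta>" .
  have "\<tau> * ((2 - p) / p) * L\<^sup>2 = \<eta>\<^sup>2 * L\<^sup>2 * ((1 + \<beta>) * (2 * (2 - p) / p\<^sup>2 * (1 - \<gamma>) / real b))"
  proof -
    have "2 / p * (a * \<eta>\<^sup>2 * v / u) * (w / p) * L\<^sup>2 = \<eta>\<^sup>2 * L\<^sup>2 * (a * (2 * w / p\<^sup>2 * v / u))" for a u v w
      by (simp add: power2_eq_square ac_simps)
    then show ?thesis unfolding \<tau>_def .
  qed
  with total show ?thesis
    unfolding \<alpha>_def by (simp only: distrib_left) (simp add: algebra_simps)
qed

text \<open>The steps below replace in turn the new staleness, the new displacement, the new distance and the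
  noise by their bounds in terms of the old state. The order matters: the new displacement occurs in
  the bound on the staleness, and the noise in those on displacement and distance. The multiples of
  \<open>\<parallel>Gm y\<parallel>\<^sup>2\<close> cancel.\<close>

lemma potential_descent:
  "(\<Sum>S\<in>batches n b. potential (step S (y, z, T)))
    \<le> N * (potential (y, z, T) - \<gamma> * (1 - \<gamma>) * \<eta>\<^sup>2 * (norm (Gm z))\<^sup>2)"
proof -
  define A where "A = (norm (y + (\<gamma> * \<eta>) *\<^sub>R Gm z - xstar))\<^sup>2"
  define D where "D = (norm (y - z))\<^sup>2"
  define t where "t = staleness y T"
  define V where "V = (\<Sum>S\<in>batches n b. (norm (noise (y, z, T) S))\<^sup>2)"
  define D' where "D' = (\<Sum>S\<in>batches n b. (norm (fst (step S (y, z, T)) - y))\<^sup>2)"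
  define t' where "t' = (\<Sum>S\<in>batches n b. staleness (fst (step S (y, z, T))) (snd (snd (step S (y, z, T)))))"
  define A' where "A' = (\<Sum>S\<in>batches n b. (norm (fst (step S (y, z, T)) + (\<gamma> * \<eta>) *\<^sub>R Gm y - xstar))\<^sup>2)"
  define g where "g = (norm (Gm y))\<^sup>2"
  define h where "h = (norm (Gm z))\<^sup>2"
  have snd_step: "fst (snd (step S (y, z, T))) = y" for S by (simp add: step_eq)
  have "(\<Sum>S\<in>batches n b. potential (step S (y, z, T))) = A' + \<alpha> * D' + \<tau> * t'"
    by (simp add: potential_def case_prod_unfold snd_step sum.distrib sum_distrib_left A'_def D'_def t'_def)
  also have "\<dots> \<le> A' + \<alpha> * D' + \<tau> * (N * ((1 - p / 2) * t) + (2 - p) / p * L\<^sup>2 * D')"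
    using staleness_step[of y z T] beta_bounds by (simp add: t'_def t_def D'_def mult_left_mono)
  also have "\<dots> = A' + \<beta> * D' + \<tau> * (N * ((1 - p / 2) * t))"
    by (simp add: \<alpha>_def algebra_simps)
  also have "\<dots> \<le> A' + \<beta> * (N * (\<eta>\<^sup>2 * ((1 - \<gamma>) * g + \<gamma> * L\<^sup>2 * D)) + \<eta>\<^sup>2 * V) + \<tau> * (N * ((1 - p / 2) * t))"
    using displacement[of y z T] beta_bounds by (simp add: D'_def D_def g_def V_def mult_left_mono)
  also have "\<dots> \<le> N * (A - \<beta> * (1 - \<gamma>) * \<eta>\<^sup>2 * g - \<gamma> * (1 - \<gamma>) * \<eta>\<^sup>2 * h + \<gamma> * (1 - \<gamma>) * \<eta>\<^sup>2 * L\<^sup>2 * D) + \<eta>\<^sup>2 * V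
      + \<beta> * (N * (\<eta>\<^sup>2 * ((1 - \<gamma>) * g + \<gamma> * L\<^sup>2 * D)) + \<eta>\<^sup>2 * V) + \<tau> * (N * ((1 - p / 2) * t))"
    using anchor_step[of y z T] by (simp add: A'_def A_def D_def g_def h_def V_def)
  also have "\<dots> = N * (A - \<gamma> * (1 - \<gamma>) * \<eta>\<^sup>2 * h + (\<gamma> * (1 - \<gamma>) * \<eta>\<^sup>2 * L\<^sup>2 + \<beta> * \<eta>\<^sup>2 * \<gamma> * L\<^sup>2) * D
      + \<tau> * (1 - p / 2) * t) + (1 + \<beta>) * \<eta>\<^sup>2 * V"
    by (simp add: algebra_simps)
  also have "\<dots> \<le> N * (A - \<gamma> * (1 - \<gamma>) * \<eta>\<^sup>2 * h + (\<gamma> * (1 - \<gamma>) * \<eta>\<^sup>2 * L\<^sup>2 + \<beta> * \<eta>\<^sup>2 * \<gamma> * L\<^sup>2) * D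
      + \<tau> * (1 - p / 2) * t) + (1 + \<beta>) * \<eta>\<^sup>2 * (N * ((1 / real b) * ((1 - \<gamma>) * t + \<gamma> * L\<^sup>2 * D)))"
    using noise_variance[of y z T] beta_bounds
    by (intro add_left_mono mult_left_mono) (auto simp: V_def t_def D_def)
  also have "\<dots> = N * (A - \<gamma> * (1 - \<gamma>) * \<eta>\<^sup>2 * h
      + (\<gamma> * (1 - \<gamma>) * \<eta>\<^sup>2 * L\<^sup>2 + \<beta> * \<eta>\<^sup>2 * \<gamma> * L\<^sup>2 + (1 + \<beta>) * \<eta>\<^sup>2 * \<gamma> * L\<^sup>2 / real b) * D
      + (\<tau> * (1 - p / 2) + (1 + \<beta>) * \<eta>\<^sup>2 * (1 - \<gamma>) / real b) * t)"
    by (simp add: algebra_simps add_divide_distrib diff_divide_distrib)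
  also have "\<tau> * (1 - p / 2) + (1 + \<beta>) * \<eta>\<^sup>2 * (1 - \<gamma>) / real b = \<tau>"
  proof -
    have "2 / p * a * (1 - p / 2) + a = 2 / p * a" for a
      using p_pos by (simp add: field_simps)
    then show ?thesis unfolding \<tau>_def .
  qed
  also have "N * (A - \<gamma> * (1 - \<gamma>) * \<eta>\<^sup>2 * h
      + (\<gamma> * (1 - \<gamma>) * \<eta>\<^sup>2 * L\<^sup>2 + \<beta> * \<eta>\<^sup>2 * \<gamma> * L\<^sup>2 + (1 + \<beta>) * \<eta>\<^sup>2 * \<gamma> * L\<^sup>2 / real b) * D + \<tau> * t)
      \<le> N * (A - \<gamma> * (1 - \<gamma>) * \<eta>\<^sup>2 * h + \<alpha> * D + \<tau> * t)"
    using mult_right_mono[OF displacement_weight, of D] by (intro mult_left_mono) (auto simp: D_def)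
  finally show ?thesis by (simp add: potential_def A_def D_def t_def h_def algebra_simps)
qed

lemma alpha_nonneg: "0 \<le> \<alpha>"
  by (rule order_trans[OF _ displacement_weight]) (use gamma beta_bounds in simp)

lemma potential_nonneg: "0 \<le> potential st"
  using alpha_nonneg beta_bounds staleness_nonneg by (cases st) (simp add: potential_def)

text \<open>Initially displacement and staleness vanish. Separating the shift \<open>\<gamma> \<eta> Gm y\<close> from \<open>y - xstar\<close> costs
  the factor \<open>2\<close> in the rate.\<close>

lemma potential_initial:
  "potential (y, y, \<lambda>i. G i y) \<le> 2 * (1 + L\<^sup>2 * \<eta>\<^sup>2) * (norm (y - xstar))\<^sup>2"
proof -
  have "(norm ((y - xstar) + (\<gamma> * \<eta>) *\<^sub>R Gm y))\<^sup>2
      \<le> (1 + 1) * (norm (y - xstar))\<^sup>2 + (1 + 1 / 1) * (norm ((\<gamma> * \<eta>) *\<^sub>R Gm y))\<^sup>2"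
    by (rule norm_sq_add_le) simp
  also have "(norm ((\<gamma> * \<eta>) *\<^sub>R Gm y))\<^sup>2 = \<gamma>\<^sup>2 * (\<eta>\<^sup>2 * (norm (Gm y))\<^sup>2)"
    by (simp add: power_mult_distrib)
  also have "\<dots> \<le> 1 * (\<eta>\<^sup>2 * (L\<^sup>2 * (norm (y - xstar))\<^sup>2))"
    using mean_lipschitz[of y xstar] gamma
    by (intro mult_mono mult_left_mono) (auto simp: xstar power_le_one)
  finally show ?thesis
    by (simp add: potential_def staleness_def algebra_simps)
qed

end

section \<open>Expectations along the method\<close>

context saga
begin

context
  fixes P :: "'w measure" and B :: "nat \<Rightarrow> 'w \<Rightarrow> nat set" and x0 :: 'v and x :: "nat \<Rightarrow> 'w \<Rightarrow> 'v"
  assumes P: "prob_space P" and unif: "uniform_minibatches P n b B"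
    and iterates: "\<And>\<omega>. \<omega> \<in> space P \<Longrightarrow> saga_iterates n b G \<gamma> \<eta> x0 (\<lambda>k. B k \<omega>) (\<lambda>k. x k \<omega>)"
begin

abbreviation "state \<omega> k \<equiv> saga_state n b G \<gamma> \<eta> x0 (\<lambda>j. B j \<omega>) k"

text \<open>The state at time \<open>k\<close> is a function of finitely many batches, hence takes finitely many values, and
  every functional of it is bounded.\<close>

lemma state_functional_integrable:
  fixes f :: "'v \<times> 'v \<times> (nat \<Rightarrow> 'v) \<Rightarrow> real"
  shows "integrable P (\<lambda>\<omega>. f (state \<omega> k))"
proof (rule uniform_resampling(1)[OF P unif, of k "\<lambda>s. f (saga_state n b G \<gamma> \<eta> x0 s k)"])
  fix s s' :: "nat \<Rightarrow> nat set" assume "\<And>j. j < Suc k \<Longrightarrow> s j = s' j"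
  then show "f (saga_state n b G \<gamma> \<eta> x0 s k) = f (saga_state n b G \<gamma> \<eta> x0 s' k)"
    by (subst saga_state_cong[of k s s']) auto
qed

lemma markov_property:
  fixes f :: "'v \<times> 'v \<times> (nat \<Rightarrow> 'v) \<Rightarrow> real"
  shows "N * prob_space.expectation P (\<lambda>\<omega>. f (state \<omega> (Suc k)))
    = prob_space.expectation P (\<lambda>\<omega>. \<Sum>S\<in>batches n b. f (step S (state \<omega> k)))"
proof -
  have "f (saga_state n b G \<gamma> \<eta> x0 s (Suc k)) = f (saga_state n b G \<gamma> \<eta> x0 s' (Suc k))"
    if "\<And>j. j < Suc k \<Longrightarrow> s j = s' j" for s s'
    using saga_state_cong[of "Suc k" s s', OF that] by metis
  note resampling = uniform_resampling(2)[OF P unif, of k "\<lambda>s. f (saga_state n b G \<gamma> \<eta> x0 s (Suc k))", OF this]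
  have "saga_state n b G \<gamma> \<eta> x0 ((\<lambda>j. B j \<omega>)(k := S)) k = state \<omega> k" for \<omega> S
    by (rule saga_state_cong) simp
  with resampling show ?thesis by simp
qed

lemma expected_potential_descent:
  "prob_space.expectation P (\<lambda>\<omega>. potential (state \<omega> (Suc k)))
    \<le> prob_space.expectation P (\<lambda>\<omega>. potential (state \<omega> k))
      - \<gamma> * (1 - \<gamma>) * \<eta>\<^sup>2 * prob_space.expectation P (\<lambda>\<omega>. (norm (Gm (fst (snd (state \<omega> k)))))\<^sup>2)"
proof -
  interpret prob_space P by (rule P)
  let ?r = "\<lambda>st. (norm (Gm (fst (snd st))))\<^sup>2"
  have "N * expectation (\<lambda>\<omega>. potential (state \<omega> (Suc k)))
      = expectation (\<lambda>\<omega>. \<Sum>S\<in>batches n b. potential (step S (state \<omega> k)))"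
    by (rule markov_property)
  also have "\<dots> \<le> expectation (\<lambda>\<omega>. N * (potential (state \<omega> k) - \<gamma> * (1 - \<gamma>) * \<eta>\<^sup>2 * ?r (state \<omega> k)))"
  proof (rule integral_mono)
    show "integrable P (\<lambda>\<omega>. \<Sum>S\<in>batches n b. potential (step S (state \<omega> k)))"
      by (rule state_functional_integrable[of "\<lambda>st. \<Sum>S\<in>batches n b. potential (step S st)"])
    show "integrable P (\<lambda>\<omega>. N * (potential (state \<omega> k) - \<gamma> * (1 - \<gamma>) * \<eta>\<^sup>2 * ?r (state \<omega> k)))"
      by (rule state_functional_integrable[of "\<lambda>st. N * (potential st - \<gamma> * (1 - \<gamma>) * \<eta>\<^sup>2 * ?r st)"])
    show "(\<Sum>S\<in>batches n b. potential (step S (state \<omega> k)))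
        \<le> N * (potential (state \<omega> k) - \<gamma> * (1 - \<gamma>) * \<eta>\<^sup>2 * ?r (state \<omega> k))" for \<omega>
      using potential_descent by (cases "state \<omega> k") simp
  qed
  also have "\<dots> = N * (expectation (\<lambda>\<omega>. potential (state \<omega> k))
      - \<gamma> * (1 - \<gamma>) * \<eta>\<^sup>2 * expectation (\<lambda>\<omega>. ?r (state \<omega> k)))"
    using state_functional_integrable[of potential k] state_functional_integrable[of ?r k] by simp
  finally show ?thesis using N_pos by simp
qed

text \<open>The descent at time \<open>k\<close> yields the residual of the previous iterate, so the potential is followed up
  to time \<open>K + 2\<close>. The first descent yields the residual of \<open>x0\<close> a second time, because the previous
  iterate is initially \<open>x0\<close> as well; that term is dropped.\<close>

lemma expected_residual_sum:
  "\<gamma> * (1 - \<gamma>) * \<eta>\<^sup>2 * (\<Sum>k=0..K. prob_space.expectation P (\<lambda>\<omega>. (norm (Gm (x k \<omega>)))\<^sup>2))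
    \<le> 2 * (1 + L\<^sup>2 * \<eta>\<^sup>2) * (norm (x0 - xstar))\<^sup>2"
proof -
  interpret prob_space P by (rule P)
  define a where "a k = expectation (\<lambda>\<omega>. potential (state \<omega> k))" for k
  define h where "h k = expectation (\<lambda>\<omega>. (norm (Gm (fst (snd (state \<omega> k)))))\<^sup>2)" for k
  let ?C = "\<gamma> * (1 - \<gamma>) * \<eta>\<^sup>2"
  have descent: "?C * h k \<le> a k - a (Suc k)" for k
    using expected_potential_descent[of k] by (simp add: a_def h_def)
  have h: "h (Suc k) = expectation (\<lambda>\<omega>. (norm (Gm (x k \<omega>)))\<^sup>2)" for k
    unfolding h_def
    by (rule Bochner_Integration.integral_cong[OF refl])
      (simp only: saga_state_eq_iterates[OF iterates] fst_conv snd_conv diff_Suc_1)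
  have "(\<Sum>k=0..K. expectation (\<lambda>\<omega>. (norm (Gm (x k \<omega>)))\<^sup>2)) \<le> (\<Sum>k<Suc (Suc K). h k)"
    unfolding sum.lessThan_Suc_shift[of h] by (simp add: h h_def[of 0] atLeast0AtMost lessThan_Suc_atMost)
  then have "?C * (\<Sum>k=0..K. expectation (\<lambda>\<omega>. (norm (Gm (x k \<omega>)))\<^sup>2)) \<le> ?C * (\<Sum>k<Suc (Suc K). h k)"
    using gamma by (intro mult_left_mono) auto
  also have "\<dots> \<le> (\<Sum>k<Suc (Suc K). a k - a (Suc k))"
    unfolding sum_distrib_left by (intro sum_mono descent)
  also have "\<dots> = a 0 - a (Suc (Suc K))" by (rule sum_lessThan_telescope')
  also have "\<dots> \<le> a 0"
    using potential_nonneg by (simp add: a_def integral_nonneg_AE)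
  also have "a 0 = potential (x0, x0, \<lambda>i. G i x0)" by (simp add: a_def prob_space)
  also have "\<dots> \<le> 2 * (1 + L\<^sup>2 * \<eta>\<^sup>2) * (norm (x0 - xstar))\<^sup>2" by (rule potential_initial)
  finally show ?thesis .
qed

end

end

section \<open>The step size and the evaluation count\<close>

lemma cube_of_two_thirds_power:
  fixes x :: real
  assumes "0 < x" shows "(x powr (2 / 3)) ^ 3 = x\<^sup>2"
proof -
  have "(x powr (2 / 3)) ^ 3 = (x powr (2 / 3)) powr 3" by simp
  also have "\<dots> = x powr 2" unfolding powr_powr by simp
  also have "\<dots> = x\<^sup>2" using assms by simp
  finally show ?thesis .
qed

lemma batch_size_bounds:
  assumes "1 \<le> b" "real b \<le> real n powr (2 / 3)"
  shows "b \<le> n" "0 < n" "real b ^ 3 \<le> (real n)\<^sup>2"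
proof -
  show n: "0 < n" using assms by (cases n) auto
  have "real b ^ 3 \<le> (real n powr (2 / 3)) ^ 3" using assms by (intro power_mono) auto
  then show "real b ^ 3 \<le> (real n)\<^sup>2" using n by (simp add: cube_of_two_thirds_power)
  have "real n powr (2 / 3) \<le> real n powr 1" using n by (intro powr_mono) auto
  then show "b \<le> n" using assms n by simp
qed

lemma saga_Lambda_nonneg: "b \<le> n \<Longrightarrow> 0 \<le> saga_Lambda n b \<gamma>"
  by (simp add: saga_Lambda_def)

lemma saga_M_pos:
  assumes "1 / 2 < \<gamma>" "b \<le> n" shows "0 < saga_M n b \<gamma>"
  unfolding saga_M_def using assms saga_Lambda_nonneg[OF assms(2)]
  by (intro add_pos_nonneg mult_nonneg_nonneg divide_pos_pos divide_nonneg_nonneg) auto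

text \<open>The polynomial under the root in \<open>saga_sigma\<close>. Its decomposition \<open>growth_poly_eq\<close> shows the origin: it
  is the numerator of \<open>saga_M\<close> with \<open>saga_Lambda\<close> replaced by \<open>10 + 8 \<gamma>\<^sup>2\<close>, a bound on \<open>b ^ 3 \<Lambda> / n\<^sup>2\<close>.\<close>

abbreviation growth_poly :: "real \<Rightarrow> real" where
  "growth_poly \<gamma> \<equiv> 10 + 61 * \<gamma> + 13 * \<gamma>\<^sup>2 + 48 * \<gamma> ^ 3"

lemma growth_poly_eq: "growth_poly \<gamma> = \<gamma> * (1 + 5 * \<gamma>) + (1 + 6 * \<gamma>) * (10 + 8 * \<gamma>\<^sup>2)"
  by (simp add: power2_eq_square power3_eq_cube algebra_simps)

lemma saga_M_eq:
  "saga_M n b \<gamma> = (\<gamma> * (1 + 5 * \<gamma>) + (1 + 6 * \<gamma>) * saga_Lambda n b \<gamma>) / (3 * (2 * \<gamma> - 1))"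
  by (simp add: saga_M_def add_divide_distrib[of "\<gamma> * (1 + 5 * \<gamma>)"])

lemma saga_M_upper:
  assumes "1 / 2 < \<gamma>" "1 \<le> b" "b \<le> n" "real b ^ 3 \<le> (real n)\<^sup>2"
  shows "saga_M n b \<gamma> \<le> (real n)\<^sup>2 * growth_poly \<gamma> / (3 * (2 * \<gamma> - 1) * real b ^ 3)"
proof -
  have b0: "0 < real b" using assms by simp
  have "saga_Lambda n b \<gamma> * real b ^ 3 = 2 * (real b)\<^sup>2 + 4 * (1 + \<gamma>\<^sup>2) * ((real n - real b) * (2 * real n + real b))"
    using b0 by (simp add: saga_Lambda_def power2_eq_square power3_eq_cube field_simps)
  also have "\<dots> \<le> 2 * (real n)\<^sup>2 + 4 * (1 + \<gamma>\<^sup>2) * (2 * (real n)\<^sup>2)"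
  proof (intro add_mono mult_left_mono)
    show "(real b)\<^sup>2 \<le> (real n)\<^sup>2" using assms by (intro power_mono) auto
    have "(real n - real b) * (2 * real n + real b) = 2 * (real n)\<^sup>2 - real b * (real n + real b)"
      by (simp add: power2_eq_square algebra_simps)
    then show "(real n - real b) * (2 * real n + real b) \<le> 2 * (real n)\<^sup>2" by simp
  qed auto
  also have "\<dots> = (10 + 8 * \<gamma>\<^sup>2) * (real n)\<^sup>2" by (simp add: algebra_simps)
  finally have Lam: "saga_Lambda n b \<gamma> * real b ^ 3 \<le> (10 + 8 * \<gamma>\<^sup>2) * (real n)\<^sup>2" .
  have "(\<gamma> * (1 + 5 * \<gamma>) + (1 + 6 * \<gamma>) * saga_Lambda n b \<gamma>) * real b ^ 3
      = \<gamma> * (1 + 5 * \<gamma>) * real b ^ 3 + (1 + 6 * \<gamma>) * (saga_Lambda n b \<gamma> * real b ^ 3)"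
    by (simp add: algebra_simps)
  also have "\<dots> \<le> \<gamma> * (1 + 5 * \<gamma>) * (real n)\<^sup>2 + (1 + 6 * \<gamma>) * ((10 + 8 * \<gamma>\<^sup>2) * (real n)\<^sup>2)"
    using assms Lam by (intro add_mono mult_left_mono) auto
  also have "\<dots> = (real n)\<^sup>2 * growth_poly \<gamma>" unfolding growth_poly_eq by (simp add: algebra_simps)
  finally have "(\<gamma> * (1 + 5 * \<gamma>) + (1 + 6 * \<gamma>) * saga_Lambda n b \<gamma>) * real b ^ 3 \<le> (real n)\<^sup>2 * growth_poly \<gamma>" .
  then have "\<gamma> * (1 + 5 * \<gamma>) + (1 + 6 * \<gamma>) * saga_Lambda n b \<gamma> \<le> (real n)\<^sup>2 * growth_poly \<gamma> / real b ^ 3"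
    using b0 by (simp add: pos_le_divide_eq)
  then have "saga_M n b \<gamma> \<le> (real n)\<^sup>2 * growth_poly \<gamma> / real b ^ 3 / (3 * (2 * \<gamma> - 1))"
    unfolding saga_M_eq using assms by (intro divide_right_mono) auto
  then show ?thesis by (simp add: mult.commute)
qed

lemma saga_eta_lower:
  assumes "1 / 2 < \<gamma>" "0 < L" "1 \<le> b" "real b \<le> real n powr (2 / 3)"
  shows "saga_sigma \<gamma> * real b powr (3 / 2) / (real n * L) \<le> saga_eta n b \<gamma> L"
proof -
  note bounds = batch_size_bounds[OF assms(3,4)]
  have b0: "0 < real b" and n0: "0 < real n" using assms bounds by auto
  define c where "c = sqrt (3 * (2 * \<gamma> - 1))"
  define r where "r = sqrt (growth_poly \<gamma>)"
  define B where "B = real b powr (3 / 2)"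
  have pos: "0 < c" "0 < r" "0 < B" using assms by (auto simp: c_def r_def B_def intro!: add_pos_nonneg)
  have "B = sqrt (real b ^ 3)"
  proof -
    have "B = (real b powr 3) powr (1 / 2)" unfolding powr_powr B_def by simp
    also have "\<dots> = sqrt (real b ^ 3)" using b0 by (simp add: powr_half_sqrt)
    finally show ?thesis .
  qed
  then have "sqrt ((real n)\<^sup>2 * growth_poly \<gamma> / (3 * (2 * \<gamma> - 1) * real b ^ 3)) = real n * r / (c * B)"
    by (simp add: c_def r_def real_sqrt_divide real_sqrt_mult)
  then have "sqrt (saga_M n b \<gamma>) \<le> real n * r / (c * B)"
    using saga_M_upper[OF assms(1,3) bounds(1,3)] by (metis real_sqrt_le_iff)
  moreover have "0 < sqrt (saga_M n b \<gamma>)" using saga_M_pos[OF assms(1) bounds(1)] by simp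
  ultimately have "1 / (L * (real n * r / (c * B))) \<le> 1 / (L * sqrt (saga_M n b \<gamma>))"
    using assms pos n0 by (intro divide_left_mono mult_left_mono mult_pos_pos divide_pos_pos) auto
  moreover have "1 / (L * (real n * r / (c * B))) = c / r * B / (real n * L)"
    using pos n0 assms by (simp add: field_simps)
  ultimately show ?thesis by (simp only: saga_eta_def saga_sigma_def c_def r_def B_def)
qed

text \<open>Since \<open>n\<^sup>2 = q ^ 3\<close>, the left-hand side is \<open>16 q ^ 3\<close> minus positive terms, and
  \<open>q < b + 1\<close> gives \<open>16 q\<^sup>2 \<le> 25 b\<^sup>2\<close> as soon as \<open>b \<ge> 4\<close>. For smaller \<open>b\<close> rounding loses more than the
  constant \<open>27\<close> allows; \<open>b = 3\<close> is saved by the negative terms, and \<open>b \<le> 2\<close> leaves the five values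
  \<open>n \<le> 5\<close>. The tight ones are \<open>n = 2\<close> and \<open>n = 5\<close>, where a rational lower bound on \<open>q\<close> is needed.\<close>

lemma floor_batch_bound:
  fixes q :: real
  assumes b: "1 \<le> b" and q: "real b \<le> q" "q < real b + 1" and cube: "q ^ 3 = (real n)\<^sup>2"
  shows "8 * ((real n - real b) * (2 * real n + real b)) + 2 * (real b)\<^sup>2 \<le> 27 * q * (real b)\<^sup>2"
proof -
  have q0: "0 < q" "1 \<le> q" using b q by auto
  have expand: "8 * ((real n - real b) * (2 * real n + real b)) + 2 * (real b)\<^sup>2
      = 16 * (q * q\<^sup>2) - 8 * real n * real b - 6 * (real b)\<^sup>2"
    using cube by (simp add: power2_eq_square power3_eq_cube algebra_simps)
  have "b ^ 3 \<le> n\<^sup>2"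
    using power_mono[OF q(1), of 3] unfolding cube by (simp flip: of_nat_power)
  moreover have "n\<^sup>2 < (b + 1) ^ 3"
  proof -
    have "q ^ 3 < (real b + 1) ^ 3" using q q0 by (intro power_strict_mono) auto
    then have "real (n\<^sup>2) < real ((b + 1) ^ 3)" unfolding cube by (simp add: add.commute)
    then show ?thesis by (simp only: of_nat_less_iff)
  qed
  ultimately have n_range: "b ^ 3 \<le> n\<^sup>2" "n\<^sup>2 < (b + 1) ^ 3" .
  consider "b = 1" | "b = 2" | "b = 3" | "4 \<le> b" using b by linarith
  then show ?thesis
  proof cases
    case 1
    have "n\<^sup>2 < 8" using n_range(2) unfolding 1 by (simp add: power3_eq_cube)
    then have "n < 3" using power_mono[of 3 n 2] by (cases "n < 3") auto
    moreover have "n \<noteq> 0" using 1 n_range by (cases n) auto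
    ultimately have "n = 1 \<or> n = 2" by linarith
    then show ?thesis
    proof
      assume n: "n = 2"
      have "14 / 9 \<le> q"
      proof (rule ccontr)
        assume "\<not> 14 / 9 \<le> q"
        then have "q ^ 3 < (14 / 9) ^ 3" using q0 by (intro power_strict_mono) auto
        then show False unfolding cube n by (simp add: power3_eq_cube)
      qed
      then show ?thesis using 1 n by simp
    qed (use 1 q0 in simp)
  next
    case 2
    then have "n < 6" using n_range power_mono[of 6 n 2] by (cases "n < 6") auto
    moreover have "3 \<le> n" using 2 n_range power_mono[of n 2 2] by (cases "3 \<le> n") auto
    ultimately have "n = 3 \<or> n = 4 \<or> n = 5" by linarith
    then consider "n = 3" | "n = 4" | "n = 5" by blast
    then show ?thesis
    proof cases
      assume n: "n = 5"
      have "11 / 4 \<le> q"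
      proof (rule ccontr)
        assume "\<not> 11 / 4 \<le> q"
        then have "q ^ 3 < (11 / 4) ^ 3" using q0 by (intro power_strict_mono) auto
        then show False unfolding cube n by (simp add: power3_eq_cube)
      qed
      then show ?thesis using 2 n by simp
    qed (use 2 q in simp_all)
  next
    case 3
    \<comment> \<open>Here \<open>16 q ^ 3\<close> may exceed \<open>27 q b\<^sup>2\<close>, but by at most \<open>13 q\<close>, and \<open>8 n b = 24 n\<close> is larger.\<close>
    have "q \<le> real n"
    proof (rule ccontr)
      assume "\<not> q \<le> real n"
      then have "(real n)\<^sup>2 < q\<^sup>2" by (intro power_strict_mono) auto
      also have "q\<^sup>2 \<le> q ^ 3" using q0 by (intro power_increasing) auto
      finally show False using cube by simp
    qed
    moreover have "q * q\<^sup>2 \<le> q * 4\<^sup>2" using q q0 3 by (intro mult_left_mono power_mono) auto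
    ultimately show ?thesis unfolding expand using 3 by simp
  next
    case 4
    have "q * q\<^sup>2 \<le> q * (5 / 4 * real b)\<^sup>2" using q q0 4 by (intro mult_left_mono power_mono) auto
    then have "16 * (q * q\<^sup>2) \<le> 25 * (q * (real b)\<^sup>2)" by (simp add: power_mult_distrib power_divide)
    moreover have "0 \<le> q * (real b)\<^sup>2" "0 \<le> real n * real b" "0 \<le> (real b)\<^sup>2" using q0 by auto
    ultimately show ?thesis unfolding expand by linarith
  qed
qed

text \<open>The quantity \<open>2 b \<Lambda>\<close> is affine in \<open>\<gamma>\<^sup>2\<close>, so it suffices to compare both sides at \<open>\<gamma>\<^sup>2 = 0\<close> and \<open>\<gamma>\<^sup>2 = 1\<close>.
  The bound \<open>b ^ 3 \<Lambda> \<le> (10 + 8 \<gamma>\<^sup>2) n\<^sup>2\<close> only gives the factor \<open>2 (q / b)\<^sup>2\<close> in place of \<open>3\<close>, and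
  \<open>(q / b)\<^sup>2\<close> is about \<open>2.5\<close> for \<open>n = 2\<close>.\<close>

lemma floor_batch_Lambda:
  fixes q :: real
  assumes gamma: "0 \<le> \<gamma>" "\<gamma> \<le> 1"
    and b: "1 \<le> b" and q: "real b \<le> q" "q < real b + 1" and cube: "q ^ 3 = (real n)\<^sup>2"
  shows "2 * real b * saga_Lambda n b \<gamma> \<le> 3 * q * (10 + 8 * \<gamma>\<^sup>2)"
proof -
  define w where "w = (real n - real b) * (2 * real n + real b) / (real b)\<^sup>2"
  have b0: "0 < real b" using b by simp
  have w: "8 * w + 2 \<le> 27 * q"
    using floor_batch_bound[OF b q cube] b0 by (simp add: w_def field_simps)
  have "2 * real b * saga_Lambda n b \<gamma> = 4 + 8 * (1 + \<gamma>\<^sup>2) * w"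
    using b0 by (simp add: saga_Lambda_def w_def field_simps power2_eq_square power3_eq_cube)
  also have "\<dots> = (1 - \<gamma>\<^sup>2) * (4 + 8 * w) + \<gamma>\<^sup>2 * (4 + 16 * w)" by (simp add: algebra_simps)
  also have "\<dots> \<le> (1 - \<gamma>\<^sup>2) * (30 * q) + \<gamma>\<^sup>2 * (54 * q)"
    using w q b gamma by (intro add_mono mult_left_mono) (auto simp: power_le_one)
  also have "\<dots> = 3 * q * (10 + 8 * \<gamma>\<^sup>2)" by (simp add: algebra_simps)
  finally show ?thesis .
qed

text \<open>The cost is \<open>2 b\<close> per iteration, and the number of iterations is proportional to
  \<open>M (1 + 1 / M)\<close>. The factor \<open>7 \<gamma> + 5 \<gamma>\<^sup>2 - 3\<close> in \<open>saga_Gamma\<close> comes from bounding \<open>1 / M\<close> with the part of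
  \<open>M\<close> that does not involve \<open>\<Lambda>\<close>.\<close>

lemma complexity_constant:
  fixes q :: real
  assumes gamma: "1 / 2 < \<gamma>" "\<gamma> < 1"
    and b: "1 \<le> b" "b \<le> n" and q: "real b \<le> q" "q < real b + 1" and cube: "q ^ 3 = (real n)\<^sup>2"
  shows "4 * real b * (saga_M n b \<gamma> + 1) / (\<gamma> * (1 - \<gamma>)) \<le> 3 * saga_Gamma \<gamma> * q"
proof -
  define d where "d = 2 * \<gamma> - 1"
  define s where "s = \<gamma> * (1 + 5 * \<gamma>)"
  define m where "m = s + (1 + 6 * \<gamma>) * saga_Lambda n b \<gamma>"
  define A where "A = growth_poly \<gamma>"
  have d0: "0 < d" and s0: "0 < s" and q0: "0 < q" using gamma b q by (auto simp: d_def s_def)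
  have s_le: "s \<le> m" using gamma saga_Lambda_nonneg[OF b(2)] by (simp add: m_def)
  have "2 * real b * m = 2 * real b * s + (1 + 6 * \<gamma>) * (2 * real b * saga_Lambda n b \<gamma>)"
    by (simp add: m_def algebra_simps)
  also have "\<dots> \<le> 3 * q * s + (1 + 6 * \<gamma>) * (3 * q * (10 + 8 * \<gamma>\<^sup>2))"
    using floor_batch_Lambda[OF _ _ b(1) q cube, of \<gamma>] gamma q s0
    by (intro add_mono mult_right_mono mult_left_mono) auto
  also have "\<dots> = 3 * q * A" unfolding A_def growth_poly_eq s_def by (simp add: algebra_simps)
  finally have bm: "2 * real b * m \<le> 3 * q * A" .
  have "saga_M n b \<gamma> + 1 = (m + 3 * d) / (3 * d)"
    using d0 unfolding saga_M_eq by (simp add: m_def s_def d_def add_divide_distrib)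
  also have "\<dots> \<le> m * (s + 3 * d) / s / (3 * d)"
    using s0 d0 s_le by (intro divide_right_mono) (auto simp: pos_le_divide_eq algebra_simps)
  finally have "2 * real b * (saga_M n b \<gamma> + 1) \<le> 2 * real b * (m * (s + 3 * d) / s / (3 * d))"
    by (intro mult_left_mono) auto
  also have "\<dots> = (2 * real b * m) * ((s + 3 * d) / (3 * d * s))" by (simp add: ac_simps)
  also have "\<dots> \<le> (3 * q * A) * ((s + 3 * d) / (3 * d * s))"
    using s0 d0 by (intro mult_right_mono bm) auto
  also have "\<dots> = q * A * (s + 3 * d) / (d * s)" using d0 s0 by (simp add: field_simps)
  finally have "2 * (2 * real b * (saga_M n b \<gamma> + 1)) / (\<gamma> * (1 - \<gamma>))
      \<le> 2 * (q * A * (s + 3 * d) / (d * s)) / (\<gamma> * (1 - \<gamma>))"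
    using gamma by (intro divide_right_mono mult_left_mono) auto
  also have "\<dots> = 3 * saga_Gamma \<gamma> * q"
  proof -
    have W: "s + 3 * d = 7 * \<gamma> + 5 * \<gamma>\<^sup>2 - 3" by (simp add: s_def d_def power2_eq_square algebra_simps)
    have "saga_Gamma \<gamma> = 2 * (s + 3 * d) * A / (3 * \<gamma>\<^sup>2 * (1 - \<gamma>) * d * (1 + 5 * \<gamma>))"
      unfolding saga_Gamma_def W A_def by (simp add: d_def)
    moreover have "2 * (q * A * w / (d * (\<gamma> * u))) / (\<gamma> * v) = 3 * (2 * w * A / (3 * \<gamma>\<^sup>2 * v * d * u)) * q"
      for u v w :: real by (simp add: power2_eq_square ac_simps)
    ultimately show ?thesis unfolding s_def by metis
  qed
  finally show ?thesis by simp
qed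

section \<open>Convergence rate and complexity\<close>

theorem corollaryC3:
  fixes G :: "nat \<Rightarrow> real ^ 'p \<Rightarrow> real ^ 'p"
    and n b :: nat
    and L \<kappa> \<gamma> :: real
    and xstar x0 :: "real ^ 'p"
    and P :: "'w measure"
    and B :: "nat \<Rightarrow> 'w \<Rightarrow> nat set"
    and x :: "nat \<Rightarrow> 'w \<Rightarrow> real ^ 'p"
  assumes zeros: "{z. mean_op n G z = 0} \<noteq> {}"
    and L_pos: "L > 0"
    and lipschitz: "\<And>y z. (1 / real n) * (\<Sum>i=1..n. (norm (G i y - G i z))\<^sup>2) \<le> L\<^sup>2 * (norm (y - z))\<^sup>2"
    and xstar: "mean_op n G xstar = 0"
    and kappa: "\<kappa> \<ge> 0"
    and weak_minty: "\<And>z. mean_op n G z \<bullet> (z - xstar) \<ge> - \<kappa> * (norm (mean_op n G z))\<^sup>2"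
    and gamma: "1 / 2 < \<gamma>" "\<gamma> < 1"
    and batch_size: "1 \<le> b" "real b \<le> real n powr (2 / 3)"
    and L_kappa: "L * \<kappa> \<le> (2 * \<gamma> - 1) / (8 * sqrt (saga_M n b \<gamma>))"
    and prob: "prob_space P"
    and sampling: "uniform_minibatches P n b B"
    and iterates: "\<And>\<omega>. \<omega> \<in> space P \<Longrightarrow>
      saga_iterates n b G \<gamma> (saga_eta n b \<gamma> L) x0 (\<lambda>k. B k \<omega>) (\<lambda>k. x k \<omega>)"
  shows "saga_eta n b \<gamma> L \<ge> saga_sigma \<gamma> * real b powr (3 / 2) / (real n * L)
    \<and> (\<forall>K::nat.
        (1 / (real K + 1)) * (\<Sum>k=0..K. prob_space.expectation P (\<lambda>\<omega>. (norm (mean_op n G (x k \<omega>)))\<^sup>2))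
        \<le> 2 * (1 + L\<^sup>2 * (saga_eta n b \<gamma> L)\<^sup>2) * (norm (x0 - xstar))\<^sup>2
           / (\<gamma> * (1 - \<gamma>) * (saga_eta n b \<gamma> L)\<^sup>2 * (real K + 1)))
    \<and> (\<forall>\<epsilon>::real. \<epsilon> > 0 \<longrightarrow> int b = \<lfloor>real n powr (2 / 3)\<rfloor> \<longrightarrow>
        (\<exists>K::nat.
          (1 / (real K + 1)) * (\<Sum>k=0..K. prob_space.expectation P (\<lambda>\<omega>. (norm (mean_op n G (x k \<omega>)))\<^sup>2)) \<le> \<epsilon>\<^sup>2
          \<and> (\<forall>\<omega>\<in>space P. int (saga_evaluations n (\<lambda>k. B k \<omega>) K)
               \<le> int n + \<lfloor>3 * saga_Gamma \<gamma> * L\<^sup>2 * (norm (x0 - xstar))\<^sup>2 * real n powr (2 / 3) / \<epsilon>\<^sup>2\<rfloor>)))"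
proof -
  interpret P: prob_space P by (rule prob)
  define \<eta> where "\<eta> = saga_eta n b \<gamma> L"
  define M where "M = saga_M n b \<gamma>"
  define R2 where "R2 = (norm (x0 - xstar))\<^sup>2"
  define avg_res where
    "avg_res K = (1 / (real K + 1)) * (\<Sum>k=0..K. P.expectation (\<lambda>\<omega>. (norm (mean_op n G (x k \<omega>)))\<^sup>2))" for K
  note bounds = batch_size_bounds[OF batch_size]
  have M0: "0 < M" unfolding M_def by (rule saga_M_pos[OF gamma(1) bounds(1)])
  have eta: "\<eta> = 1 / (L * sqrt M)" by (simp add: \<eta>_def saga_eta_def M_def)
  then have eta0: "0 < \<eta>" and eta_sq: "\<eta>\<^sup>2 = 1 / (L\<^sup>2 * M)"
    using L_pos M0 by (simp_all add: power_divide power_mult_distrib)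
  interpret saga G n b L \<gamma> \<eta> \<kappa> xstar
  proof
    have "8 * \<kappa> * (L * sqrt M) \<le> 2 * \<gamma> - 1"
      using L_kappa M0 by (simp add: M_def[symmetric] field_simps)
    then show "8 * \<kappa> \<le> (2 * \<gamma> - 1) * \<eta>"
      using L_pos M0 by (simp add: eta pos_le_divide_eq)
    show "L\<^sup>2 * \<eta>\<^sup>2 * saga_M n b \<gamma> \<le> 1" using L_pos M0 by (simp add: eta_sq flip: M_def)
  qed (use batch_size(1) bounds L_pos eta0 gamma lipschitz xstar weak_minty in auto)
  have rate: "avg_res K \<le> 2 * (1 + L\<^sup>2 * \<eta>\<^sup>2) * R2 / (\<gamma> * (1 - \<gamma>) * \<eta>\<^sup>2 * (real K + 1))" for K
  proof -
    have C: "0 < \<gamma> * (1 - \<gamma>) * \<eta>\<^sup>2" using gamma eta0 by simp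
    have "avg_res K * (\<gamma> * (1 - \<gamma>) * \<eta>\<^sup>2 * (real K + 1)) \<le> 2 * (1 + L\<^sup>2 * \<eta>\<^sup>2) * R2"
      using expected_residual_sum[OF prob sampling iterates[folded \<eta>_def], of K]
      by (simp add: avg_res_def R2_def mult_ac)
    then show ?thesis using C by (subst pos_le_divide_eq) auto
  qed
  have complexity: "\<exists>K. avg_res K \<le> \<epsilon>\<^sup>2 \<and> (\<forall>\<omega>\<in>space P. int (saga_evaluations n (\<lambda>k. B k \<omega>) K)
      \<le> int n + \<lfloor>3 * saga_Gamma \<gamma> * L\<^sup>2 * R2 * real n powr (2 / 3) / \<epsilon>\<^sup>2\<rfloor>)"
    if eps: "\<epsilon> > 0" and floor: "int b = \<lfloor>real n powr (2 / 3)\<rfloor>" for \<epsilon>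
  proof -
    define q where "q = real n powr (2 / 3)"
    have "real_of_int (int b) \<le> q" "q < real_of_int (int b) + 1"
      unfolding floor q_def by linarith+
    moreover have "q ^ 3 = (real n)\<^sup>2" using bounds by (simp add: q_def cube_of_two_thirds_power)
    ultimately have const: "4 * real b * (M + 1) / (\<gamma> * (1 - \<gamma>)) \<le> 3 * saga_Gamma \<gamma> * q"
      using complexity_constant[OF gamma batch_size(1) bounds(1)] by (simp add: M_def)
    \<comment> \<open>\<open>Q\<close> is the real number of iterations at which the rate reaches \<open>\<epsilon>\<^sup>2\<close>. For \<open>Q = 0\<close>, that is
      when the method starts at \<open>xstar\<close>, the truncated subtraction below still gives \<open>K = 0\<close>.\<close>
    define Q where "Q = 2 * (M + 1) * L\<^sup>2 * R2 / (\<gamma> * (1 - \<gamma>) * \<epsilon>\<^sup>2)"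
    have Q0: "0 \<le> Q" using gamma M0 by (simp add: Q_def R2_def)
    define K where "K = nat \<lceil>Q\<rceil> - 1"
    have K_ge: "Q \<le> real K + 1" and K_le: "real K \<le> Q"
      using Q0 unfolding K_def by linarith+
    have "avg_res K \<le> 2 * (1 + L\<^sup>2 * \<eta>\<^sup>2) * R2 / (\<gamma> * (1 - \<gamma>) * \<eta>\<^sup>2 * (real K + 1))" by (rule rate)
    also have "\<dots> = \<epsilon>\<^sup>2 * Q / (real K + 1)"
    proof -
      have "2 * (1 + l * (1 / (l * M))) * R2 / (\<gamma> * v * (1 / (l * M)) * u)
          = e * (2 * (M + 1) * l * R2 / (\<gamma> * v * e)) / u" if "l > 0" "e > 0" "v > 0" "u > 0" for l e v u
        using that M0 gamma by (simp add: field_simps)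
      from this[of "L\<^sup>2" "\<epsilon>\<^sup>2" "1 - \<gamma>" "real K + 1"] show ?thesis
        using L_pos gamma eps by (simp add: eta_sq Q_def)
    qed
    also have "\<dots> \<le> \<epsilon>\<^sup>2" using K_ge by (simp add: pos_divide_le_eq mult_left_mono)
    finally have acc: "avg_res K \<le> \<epsilon>\<^sup>2" .
    have "2 * real b * real K \<le> 2 * real b * Q" using K_le by (intro mult_left_mono) auto
    also have "\<dots> = (4 * real b * (M + 1) / (\<gamma> * (1 - \<gamma>))) * (L\<^sup>2 * R2 / \<epsilon>\<^sup>2)" by (simp add: Q_def)
    also have "\<dots> \<le> 3 * saga_Gamma \<gamma> * q * (L\<^sup>2 * R2 / \<epsilon>\<^sup>2)"
      by (intro mult_right_mono const) (simp add: R2_def)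
    also have "\<dots> = 3 * saga_Gamma \<gamma> * L\<^sup>2 * R2 * q / \<epsilon>\<^sup>2" by simp
    finally have cost: "int (2 * b * K) \<le> \<lfloor>3 * saga_Gamma \<gamma> * L\<^sup>2 * R2 * q / \<epsilon>\<^sup>2\<rfloor>"
      by (simp add: le_floor_iff)
    have "saga_evaluations n (\<lambda>k. B k \<omega>) K = n + 2 * b * K" if "\<omega> \<in> space P" for \<omega>
    proof -
      have "card (B k \<omega>) = b" for k
        using uniform_minibatches_mem[OF prob sampling that, of k] by (simp add: batches_def)
      then show ?thesis by (simp add: saga_evaluations_def)
    qed
    with acc cost show ?thesis unfolding q_def[symmetric] by (intro exI[of _ K]) simp
  qed
  have "saga_eta n b \<gamma> L \<ge> saga_sigma \<gamma> * real b powr (3 / 2) / (real n * L)"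
    by (rule saga_eta_lower[OF gamma(1) L_pos batch_size])
  with rate complexity show ?thesis
    unfolding avg_res_def R2_def \<eta>_def by blast
qed

end
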